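(* Suppose that $K_1,K_2:L^2(\rho_{d-1})\to L^2(\rho_{d-1})$ are positive semi-definite linear operators defined as integral operators associated with positive semi-definite kernels $k_1,k_2:\mathbb{S}^{d-1}\times\mathbb{S}^{d-1}\to\mathbb{R}$, i.e. $$K_1f(\mathbf{x})=\mathbb{E}_{\mathbf{x}'}[k_1(\mathbf{x},\mathbf{x}')f(\mathbf{x}')],\qquad K_2f(\mathbf{x})=\mathbb{E}_{\mathbf{x}'}[k_2(\mathbf{x},\mathbf{x}')f(\mathbf{x}')].$$ Define a linear operator $K:L^2(\rho_{d-1})\to L^2(\rho_{d-1})$ by $Kf(\mathbf{x})=\mathbb{E}_{\mathbf{x}'}[k_1(\mathbf{x},\mathbf{x}')k_2(\mathbf{x},\mathbf{x}')f(\mathbf{x}')]$. Then $$\lVert K\rVert_2\le\lVert K_2\rVert_2\sup_{\mathbf{x}\in\mathbb{S}^{d-1}}|k_1(\mathbf{x},\mathbf{x})|.$$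
   Context: $\rho_{d-1}$ is the uniform probability distribution on the unit sphere $\mathbb{S}^{d-1}\subset\mathbb{R}^d$; $\mathbb{E}_{\mathbf{x}'}$ denotes expectation over $\mathbf{x}'\sim\rho_{d-1}$. For a linear operator $K$ on $L^2(\rho_{d-1})$, $\lVert K\rVert_2=\sup_{\lVert f\rVert_2=1}\lVert Kf\rVert_2$ is the operator norm. *)

theory Defs
  imports "HOL-Probability.Probability"
begin

text \<open>
  The uniform probability distribution on the unit sphere is the image of the uniform distribution
  on the unit ball under radial projection \<open>sgn x = x /\<^sub>R norm x\<close>.  The centre, where
  \<open>sgn 0 = 0\<close>, is a null set, so restricting to the sphere loses no mass.  The lemmas below
  confirm that this is a rotation-invariant probability measure on the sphere; the sort
  \<open>wellorder\<close> there is inherited from \<open>measure_orthogonal_image\<close>.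
\<close>

definition sphere_measure :: "'a::euclidean_space measure" where
  "sphere_measure =
     restrict_space (distr (uniform_measure lborel (ball 0 1)) borel sgn) (sphere 0 1)"

lemma space_sphere_measure: "space sphere_measure = sphere 0 1"
  by (simp add: sphere_measure_def space_restrict_space)

lemma sets_sphere_measure: "sets sphere_measure = sets (restrict_space borel (sphere 0 1))"
  by (simp add: sphere_measure_def sets_restrict_space)

lemma sgn_borel_measurable:
  "(sgn :: 'a::euclidean_space \<Rightarrow> 'a) \<in> borel_measurable borel"
  unfolding sgn_div_norm by measurable

lemma emeasure_unit_ball:
  "emeasure lborel (ball (0::'a::euclidean_space) 1) \<noteq> 0"
  "emeasure lborel (ball (0::'a::euclidean_space) 1) < \<infinity>"
  using unit_ball_vol_pos[of "real DIM('a)"] emeasure_lborel_ball_finite[of "0::'a" 1]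
  by (auto simp: emeasure_ball ennreal_eq_0_iff not_le)

lemma prob_space_unit_ball:
  "prob_space (uniform_measure lborel (ball (0::'a::euclidean_space) 1))"
  using emeasure_unit_ball by (intro prob_space_uniform_measure) (auto simp: less_top)

lemma emeasure_sphere_measure:
  assumes "A \<in> sets borel" "A \<subseteq> sphere 0 1"
  shows "emeasure (sphere_measure :: 'a::euclidean_space measure) A =
           emeasure (uniform_measure lborel (ball 0 1)) (sgn -` A)"
proof -
  let ?D = "distr (uniform_measure lborel (ball (0::'a) 1)) borel sgn"
  have m: "(sgn::'a \<Rightarrow> 'a) \<in> measurable (uniform_measure lborel (ball 0 1)) borel"
    using sgn_borel_measurable by simp
  have "emeasure sphere_measure A = emeasure ?D A"
    unfolding sphere_measure_def using assms by (intro emeasure_restrict_space) auto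
  then show ?thesis
    using emeasure_distr[OF m assms(1)] by simp
qed

lemma prob_space_sphere_measure: "prob_space (sphere_measure :: 'a::euclidean_space measure)"
proof
  interpret B: prob_space "uniform_measure lborel (ball (0::'a) 1)"
    by (rule prob_space_unit_ball)
  have eq: "sgn -` sphere (0::'a) 1 = - {0}"
    by (auto simp: norm_sgn)
  have "AE x in lborel. x \<noteq> (0::'a)"
    by (rule AE_lborel_singleton)
  then have "AE x in uniform_measure lborel (ball (0::'a) 1). x \<in> - {0}"
    by (subst AE_uniform_measure) (use emeasure_unit_ball in auto)
  then have "emeasure (uniform_measure lborel (ball (0::'a) 1)) (- {0}) = 1"
    by (intro B.emeasure_eq_1_AE) auto
  then show "emeasure (sphere_measure :: 'a measure) (space sphere_measure) = 1"
    by (simp add: space_sphere_measure emeasure_sphere_measure eq)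
qed

lemma sphere_measure_orthogonal_invariant:
  fixes f :: "real ^ 'n::{finite,wellorder} \<Rightarrow> real ^ 'n::{finite,wellorder}"
  assumes f: "orthogonal_transformation f" and A: "A \<in> sets borel" "A \<subseteq> sphere 0 1"
  shows "emeasure sphere_measure (f ` A) = emeasure sphere_measure A"
proof -
  have inj: "inj f" and lin: "linear f" and surj: "surj f"
    using f by (auto simp: orthogonal_transformation_inj orthogonal_transformation_linear
        orthogonal_transformation_surj)
  have nrm: "norm (f x) = norm x" for x
    using f by (rule orthogonal_transformation_norm)
  have borel_image: "f ` B \<in> sets borel" if "B \<in> sets borel" for B
  proof -
    have "inv f \<in> borel_measurable borel"
      using orthogonal_transformation_inv[OF f]
      by (intro borel_measurable_continuous_onI linear_continuous_on)
        (metis orthogonal_transformation_linear linear_conv_bounded_linear)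
    moreover have "inv f -` B = f ` B"
      using bij_vimage_eq_inv_image[of "inv f" B] inj surj
      by (simp add: bij_def inv_inv_eq surj_imp_inj_inv inj_imp_surj_inv)
    ultimately show ?thesis
      using measurable_sets[OF _ that, of "inv f" borel] by simp
  qed
  have sgn_f: "sgn (f x) = f (sgn x)" for x
    using lin by (simp add: sgn_div_norm nrm linear_scale)
  let ?B = "ball 0 1 \<inter> sgn -` A"
  have sgn_A: "sgn -` A \<in> sets borel"
    using measurable_sets[OF sgn_borel_measurable A(1)] by simp
  have fA: "f ` A \<in> sets borel" "f ` A \<subseteq> sphere 0 1"
    using A borel_image by (auto simp: nrm)
  have sgn_fA: "sgn -` (f ` A) \<in> sets borel"
    using measurable_sets[OF sgn_borel_measurable fA(1)] by simp
  have img: "ball 0 1 \<inter> sgn -` (f ` A) = f ` ?B"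
  proof (intro equalityI subsetI)
    fix y assume y: "y \<in> ball 0 1 \<inter> sgn -` (f ` A)"
    obtain x where x: "y = f x" using surj by blast
    with y have "f (sgn x) \<in> f ` A" by (simp add: sgn_f)
    then have "sgn x \<in> A" using inj by (auto dest: injD)
    with x y show "y \<in> f ` ?B" by (auto simp: nrm)
  qed (auto simp: nrm sgn_f)
  have fin: "?B \<in> lmeasurable"
    using sgn_A by (intro bounded_set_imp_lmeasurable) (auto simp: bounded_Int)
  have fin': "f ` ?B \<in> lmeasurable"
    using sgn_A borel_image[of ?B] bounded_linear_image[of ?B f] lin
    by (intro bounded_set_imp_lmeasurable) (auto simp: bounded_Int linear_conv_bounded_linear)
  have "emeasure lborel (f ` ?B) = emeasure lebesgue (f ` ?B)"
    using borel_image[of ?B] sgn_A by simp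
  also have "\<dots> = emeasure lebesgue ?B"
    using measure_orthogonal_image[OF f fin] fin fin'
    by (simp add: emeasure_eq_measure2 fmeasurableD2)
  also have "\<dots> = emeasure lborel ?B"
    using sgn_A by simp
  finally show ?thesis
    using A fA sgn_A sgn_fA by (simp add: emeasure_sphere_measure img)
qed

text \<open>
  Elements of the real space \<open>L\<^sup>2(M)\<close> are represented by functions, and equality of elements by
  equality almost everywhere.  The norm is extended by \<open>\<infinity>\<close> to functions outside \<open>L\<^sup>2(M)\<close>, so that a
  finite operator norm can never stem from the default value of a divergent integral.  Products of
  norms and suprema are taken in \<open>ennreal\<close>, where \<open>0 * \<infinity> = 0\<close>.
\<close>

definition L2 :: "'a measure \<Rightarrow> ('a \<Rightarrow> real) set" where
  "L2 M = {f \<in> borel_measurable M. integrable M (\<lambda>x. (f x)\<^sup>2)}"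

definition L2_inner :: "'a measure \<Rightarrow> ('a \<Rightarrow> real) \<Rightarrow> ('a \<Rightarrow> real) \<Rightarrow> real" where
  "L2_inner M f g = (\<integral>x. f x * g x \<partial>M)"

definition L2_norm :: "'a measure \<Rightarrow> ('a \<Rightarrow> real) \<Rightarrow> ennreal" where
  "L2_norm M f = (if f \<in> L2 M then ennreal (sqrt (L2_inner M f f)) else \<infinity>)"

definition L2_linear_operator :: "'a measure \<Rightarrow> (('a \<Rightarrow> real) \<Rightarrow> 'a \<Rightarrow> real) \<Rightarrow> bool" where
  "L2_linear_operator M T \<longleftrightarrow>
     (\<forall>f\<in>L2 M. T f \<in> L2 M) \<and>
     (\<forall>f\<in>L2 M. \<forall>g\<in>L2 M. (AE x in M. f x = g x) \<longrightarrow> (AE x in M. T f x = T g x)) \<and>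
     (\<forall>f\<in>L2 M. \<forall>g\<in>L2 M. AE x in M. T (\<lambda>y. f y + g y) x = T f x + T g x) \<and>
     (\<forall>f\<in>L2 M. \<forall>c. AE x in M. T (\<lambda>y. c * f y) x = c * T f x)"

definition L2_psd_operator :: "'a measure \<Rightarrow> (('a \<Rightarrow> real) \<Rightarrow> 'a \<Rightarrow> real) \<Rightarrow> bool" where
  "L2_psd_operator M T \<longleftrightarrow>
     L2_linear_operator M T \<and>
     (\<forall>f\<in>L2 M. \<forall>g\<in>L2 M. L2_inner M (T f) g = L2_inner M f (T g)) \<and>
     (\<forall>f\<in>L2 M. 0 \<le> L2_inner M f (T f))"

definition L2_opnorm :: "'a measure \<Rightarrow> (('a \<Rightarrow> real) \<Rightarrow> 'a \<Rightarrow> real) \<Rightarrow> ennreal" where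
  "L2_opnorm M T = (SUP f \<in> {f \<in> L2 M. L2_norm M f = 1}. L2_norm M (T f))"

definition integral_op :: "'a measure \<Rightarrow> ('a \<Rightarrow> 'a \<Rightarrow> real) \<Rightarrow> ('a \<Rightarrow> real) \<Rightarrow> 'a \<Rightarrow> real" where
  "integral_op M k f x = (\<integral>y. k x y * f y \<partial>M)"

text \<open>
  The kernel \<open>k\<close> defines an integral operator on \<open>L\<^sup>2(M)\<close>: for every \<open>f\<close> the defining integral exists
  (as a Lebesgue integral) for almost every \<open>x\<close>, and the result is a linear operator on \<open>L\<^sup>2(M)\<close>.
\<close>

definition L2_integral_operator :: "'a measure \<Rightarrow> ('a \<Rightarrow> 'a \<Rightarrow> real) \<Rightarrow> bool" where
  "L2_integral_operator M k \<longleftrightarrow>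
     (\<lambda>(x, y). k x y) \<in> borel_measurable (M \<Otimes>\<^sub>M M) \<and>
     (\<forall>f\<in>L2 M. AE x in M. integrable M (\<lambda>y. k x y * f y)) \<and>
     L2_linear_operator M (integral_op M k)"

definition psd_kernel :: "'a set \<Rightarrow> ('a \<Rightarrow> 'a \<Rightarrow> real) \<Rightarrow> bool" where
  "psd_kernel S k \<longleftrightarrow>
     (\<forall>x\<in>S. \<forall>y\<in>S. k x y = k y x) \<and>
     (\<forall>F c. finite F \<and> F \<subseteq> S \<longrightarrow> 0 \<le> (\<Sum>x\<in>F. \<Sum>y\<in>F. c x * c y * k x y))"

end

theory Submission
  imports Defs
begin

text \<open>
  A kernel of the form \<open>\<Sum>l<n. v l x * v l y\<close> splits the form of the Schur product into pieces
  \<open>\<langle>g * v l, K\<^sub>2 (f * v l)\<rangle>\<close>.  Bounding each by \<open>\<parallel>K\<^sub>2\<parallel>\<close> and applying the Cauchy--Schwarz inequality over \<open>l\<close>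
  leaves only the diagonal of the kernel.  The kernel \<open>k1\<close> is a limit in \<open>L\<^sup>1(M \<times> M)\<close> of kernels of this
  form: its averages over the cells of a finite partition are positive semi-definite step functions
  whose values are bounded by \<open>sup k1 x x\<close>, so that no spectral decomposition is needed.  The limit is
  harmless as long as \<open>g x * k2 x y * f y\<close> is bounded.  General \<open>f\<close> and \<open>g\<close> are truncated to the sets
  where \<open>k2 x x \<le> n\<close>, on which \<open>\<bar>k2 x y\<bar> \<le> n\<close>, and Fatou's lemma removes the truncation.  If
  \<open>\<parallel>K\<^sub>2\<parallel> = 0\<close> while \<open>k1\<close> is unbounded on the diagonal, then the same bound with a truncation of \<open>k2\<close> in the
  role of \<open>k1\<close> shows that \<open>k2\<close> vanishes almost everywhere.
\<close>

subsection \<open>Positive semi-definite kernels\<close>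

lemma psd_kernel_subset: "psd_kernel S k \<Longrightarrow> T \<subseteq> S \<Longrightarrow> psd_kernel T k"
  unfolding psd_kernel_def by (auto simp: subset_iff)

lemma psd_kernel_sym: "psd_kernel S k \<Longrightarrow> x \<in> S \<Longrightarrow> y \<in> S \<Longrightarrow> k x y = k y x"
  unfolding psd_kernel_def by blast

lemma psd_kernel_sum_nonneg:
  "psd_kernel S k \<Longrightarrow> finite F \<Longrightarrow> F \<subseteq> S \<Longrightarrow> 0 \<le> (\<Sum>x\<in>F. \<Sum>y\<in>F. c x * c y * k x y)"
  unfolding psd_kernel_def by blast

lemma psd_kernel_diag_nonneg:
  assumes "psd_kernel S k" "x \<in> S"
  shows "0 \<le> k x x"
  using psd_kernel_sum_nonneg[OF assms(1), of "{x}" "\<lambda>_. 1"] assms(2) by simp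

lemma psd_kernel_binary_form_nonneg:
  assumes k: "psd_kernel S k" and xy: "x \<in> S" "y \<in> S" "x \<noteq> y"
  shows "0 \<le> a\<^sup>2 * k x x + 2 * a * b * k x y + b\<^sup>2 * k y y"
  using psd_kernel_sum_nonneg[OF k, of "{x, y}" "\<lambda>z. if z = x then a else b"]
    psd_kernel_sym[OF k xy(1,2)] xy
  by (simp add: power2_eq_square algebra_simps)

text \<open>The discriminant of a nonnegative binary form is nonpositive. The index set is arbitrary
  because the lemma serves twice: for kernels on points, and with \<open>L2_inner\<close> as a
  kernel on \<open>L2 M\<close>.\<close>

lemma psd_kernel_Cauchy_Schwarz:
  assumes k: "psd_kernel S k" and xy: "x \<in> S" "y \<in> S"
  shows "(k x y)\<^sup>2 \<le> k x x * k y y"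
proof (cases "x = y")
  case False
  note form = psd_kernel_binary_form_nonneg[OF k xy False]
  show ?thesis
  proof (cases "k y y = 0")
    case True
    have "k x y = 0"
    proof (rule ccontr)
      assume "k x y \<noteq> 0"
      \<comment> \<open>With \<open>k y y = 0\<close> the form is affine in \<open>b\<close>, and
        this \<open>b\<close> gives it the value -1 at \<open>a = 1\<close>.\<close>
      then show False
        using form[of 1 "- (k x x + 1) / (2 * k x y)"] True
          by (simp add: field_simps)
    qed
    with True show ?thesis by simp
  next
    case False
    then have pos: "k y y > 0"
      using psd_kernel_diag_nonneg[OF k xy(2)] by simp
    \<comment> \<open>The ratio \<open>b / a = - k x y / k y y\<close> minimises the form; scaling
      by \<open>k y y\<close> clears the denominator.\<close>
    have "0 \<le> k y y * (k x x * k y y - (k x y)\<^sup>2)"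
      using form[of "k y y" "- k x y"] by (simp add: power2_eq_square algebra_simps)
    with pos show ?thesis
      by (simp add: zero_le_mult_iff)
  qed
qed (simp add: power2_eq_square)

text \<open>By Cauchy--Schwarz the diagonal controls the whole kernel. This turns the supremum of
  \<open>k1 x x\<close> and the truncation \<open>k2 x x \<le> real n\<close> into pointwise bounds
  on the kernels.\<close>

lemma psd_kernel_abs_le:
  assumes k: "psd_kernel S k" and xy: "x \<in> S" "y \<in> S" and C: "k x x \<le> C" "k y y \<le> C"
  shows "\<bar>k x y\<bar> \<le> C"
proof -
  have nn: "0 \<le> k x x" "0 \<le> k y y"
    using psd_kernel_diag_nonneg[OF k] xy by auto
  have "(k x y)\<^sup>2 \<le> k x x * k y y"
    by (rule psd_kernel_Cauchy_Schwarz[OF k xy])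
  also have "\<dots> \<le> C * C"
    using C nn by (intro mult_mono) linarith+
  finally have "\<bar>k x y\<bar>\<^sup>2 \<le> C\<^sup>2"
    by (simp add: power2_eq_square)
  then show ?thesis
    using C(1) nn by (elim power2_le_imp_le) linarith
qed

section \<open>Gram representation on finite sets\<close>

text \<open>This eliminates the point \<open>a\<close>: minimising the quadratic form over the
  coefficient of \<open>a\<close> leaves the form of the new kernel. If \<open>k a a = 0\<close>,
  then \<open>x / 0 = 0\<close> makes the correction vanish, and the claim is about the restriction
  of \<open>k\<close> to \<open>F\<close>.\<close>

lemma psd_kernel_Schur_complement:
  assumes k: "psd_kernel (insert a F) k" and F: "finite F" "a \<notin> F"
  shows "psd_kernel F (\<lambda>x y. k x y - k x a * k y a / k a a)"
proof (cases "k a a = 0")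
  case True
  then show ?thesis
    using psd_kernel_subset[OF k subset_insertI] by simp
next
  case False
  show ?thesis
    unfolding psd_kernel_def
  proof (intro conjI ballI allI impI)
    fix x y assume "x \<in> F" "y \<in> F"
    then have "k x y = k y x"
      using psd_kernel_sym[OF k] by blast
    then show "k x y - k x a * k y a / k a a = k y x - k y a * k x a / k a a"
      by (metis mult.commute)
  next
    fix G c assume "finite G \<and> G \<subseteq> F"
    then have G: "finite G" "G \<subseteq> F" "a \<notin> G" using F by auto
    define t where "t = (\<Sum>x\<in>G. c x * k x a)"
    define w where "w = (\<lambda>x. \<Sum>y\<in>G. c y * k x y)"
    \<comment> \<open>The value \<open>- t / k a a\<close> at \<open>a\<close> minimises
      \<open>k a a * s^2 + 2 * t * s\<close> in \<open>s\<close>.\<close>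
    define d where "d = (\<lambda>x. if x = a then - t / k a a else c x)"
    have d: "(\<Sum>x\<in>G. d x * f x) = (\<Sum>x\<in>G. c x * f x)" for f
      unfolding d_def using G(3) by (intro sum.cong) auto
    have sym: "k a x = k x a" if "x \<in> G" for x
      using psd_kernel_sym[OF k] that G(2) by blast
    have sa: "(\<Sum>x\<in>G. c x * k a x) = t"
      unfolding t_def by (rule sum.cong) (use sym in auto)
    have "0 \<le> (\<Sum>x\<in>insert a G. \<Sum>y\<in>insert a G. d x * d y * k x y)"
      using G by (intro psd_kernel_sum_nonneg[OF k]) auto
    also have "\<dots> = (\<Sum>x\<in>insert a G. d x * (\<Sum>y\<in>insert a G. d y * k x y))"
      unfolding sum_distrib_left mult.assoc ..
    also have "\<dots> = d a * (d a * k a a + t) + (\<Sum>x\<in>G. c x * (d a * k x a + w x))"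
      using G by (simp add: d sa w_def)
    also have "\<dots> = d a * (d a * k a a + t) + (d a * t + (\<Sum>x\<in>G. c x * w x))"
    proof -
      have "(\<Sum>x\<in>G. c x * (d a * k x a + w x)) = d a * t + (\<Sum>x\<in>G. c x * w x)"
        unfolding t_def sum_distrib_left sum.distrib[symmetric]
        by (intro sum.cong) (auto simp: algebra_simps)
      then show ?thesis by simp
    qed
    also have "\<dots> = (\<Sum>x\<in>G. c x * w x) - t * t / k a a"
      using False by (simp add: d_def)
    also have "\<dots> = (\<Sum>x\<in>G. \<Sum>y\<in>G. c x * c y * (k x y - k x a * k y a / k a a))"
    proof -
      have "t * t / k a a = (\<Sum>x\<in>G. \<Sum>y\<in>G. (c x * k x a) * (c y * k y a) / k a a)"
        unfolding t_def sum_product sum_divide_distrib ..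
      moreover have "(\<Sum>x\<in>G. c x * w x) = (\<Sum>x\<in>G. \<Sum>y\<in>G. c x * (c y * k x y))"
        unfolding w_def sum_distrib_left ..
      ultimately show ?thesis
        by (simp only: sum_subtractf right_diff_distrib times_divide_eq_right mult_ac)
    qed
    finally show "0 \<le> \<dots>" .
  qed
qed

text \<open>Cholesky factorisation by induction over the points: each elimination step splits off
  one rank-one term.\<close>

lemma psd_kernel_Gram:
  assumes "finite F" "psd_kernel F k"
  shows "\<exists>(n::nat) v. \<forall>x\<in>F. \<forall>y\<in>F. k x y = (\<Sum>l<n. v l x * v l y)"
  using assms
proof (induction F arbitrary: k rule: finite_induct)
  case (insert a F)
  let ?k = "\<lambda>x y. k x y - k x a * k y a / k a a"
  obtain n :: nat and v where v: "\<And>x y. x \<in> F \<Longrightarrow> y \<in> F \<Longrightarrow> ?k x y = (\<Sum>l<n. v l x * v l y)"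
    using insert.IH[OF psd_kernel_Schur_complement[OF insert.prems insert.hyps(1,2)]] by blast
  \<comment> \<open>Feature \<open>n\<close> is the column of \<open>a\<close> divided by
    \<open>sqrt (k a a)\<close>, hence 0 if \<open>k a a = 0\<close>. The old features are extended
    by 0 to \<open>a\<close>, where the Schur complement vanishes.\<close>
  define w where "w = (\<lambda>l x. if l = n then k x a / sqrt (k a a) else if x = a then 0 else v l x)"
  have nn: "0 \<le> k a a"
    using psd_kernel_diag_nonneg[OF insert.prems] by simp
  \<comment> \<open>If \<open>k a a = 0\<close>, the left side is 0 by \<open>x / 0 = 0\<close>, and
    Cauchy--Schwarz gives \<open>k x a = 0\<close>.\<close>
  have row: "k x a * k a a / k a a = k x a" if "x \<in> insert a F" for x
    using psd_kernel_Cauchy_Schwarz[OF insert.prems that, of a] by (cases "k a a = 0") auto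
  have "k x y = (\<Sum>l<Suc n. w l x * w l y)" if xy: "x \<in> insert a F" "y \<in> insert a F" for x y
  proof -
    have "(\<Sum>l<Suc n. w l x * w l y) = (\<Sum>l<n. w l x * w l y) + k x a * k y a / k a a"
      using nn by (simp add: w_def)
    also have "(\<Sum>l<n. w l x * w l y) = ?k x y"
    proof (cases "x = a \<or> y = a")
      case True
      then have "(\<Sum>l<n. w l x * w l y) = 0"
        by (intro sum.neutral) (auto simp: w_def)
      moreover have "?k x y = 0"
        using True row[OF xy(1)] row[OF xy(2)] psd_kernel_sym[OF insert.prems xy]
        by (auto simp: mult.commute)
      ultimately show ?thesis by simp
    next
      case False
      then have "(\<Sum>l<n. w l x * w l y) = (\<Sum>l<n. v l x * v l y)"
        by (intro sum.cong) (auto simp: w_def)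
      then show ?thesis using v[of x y] xy False by auto
    qed
    finally show ?thesis by simp
  qed
  then show ?case by blast
qed simp

subsection \<open>Approximation by step functions on finite partitions\<close>

text \<open>A finite measurable partition is coded by labels: its cells are the fibres of
  \<open>p\<close>, and \<open>S\<close> lists the values on products of cells. Both coordinates
  share one partition, so that averages over the cells form a square matrix indexed by the labels.
  The integral of a non-integrable function is 0, which is why sums and limits below assume
  integrability.\<close>

definition step_approximable :: "'a measure \<Rightarrow> ('a \<times> 'a \<Rightarrow> real) \<Rightarrow> bool" where
  "step_approximable M h \<longleftrightarrow>
     (\<forall>e>0. \<exists>(p :: 'a \<Rightarrow> nat) S. simple_function M p \<and>
        (\<integral>z. \<bar>h z - S (p (fst z)) (p (snd z))\<bar> \<partial>(M \<Otimes>\<^sub>M M)) < e)"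

lemma step_approximableE:
  assumes "step_approximable M h" "e > 0"
  obtains p :: "'a \<Rightarrow> nat" and S where "simple_function M p"
    "(\<integral>z. \<bar>h z - S (p (fst z)) (p (snd z))\<bar> \<partial>(M \<Otimes>\<^sub>M M)) < e"
proof -
  have "\<exists>(p :: 'a \<Rightarrow> nat) S. simple_function M p \<and>
      (\<integral>z. \<bar>h z - S (p (fst z)) (p (snd z))\<bar> \<partial>(M \<Otimes>\<^sub>M M)) < e"
    using assms unfolding step_approximable_def by simp
  then show ?thesis
    by (elim exE conjE) (rule that)
qed

lemma simple_function_step:
  assumes "simple_function M p"
  shows "simple_function (M \<Otimes>\<^sub>M M) (\<lambda>z. S (p (fst z)) (p (snd z)))"
proof -
  have "simple_function (M \<Otimes>\<^sub>M M) (\<lambda>z. p (fst z))" "simple_function (M \<Otimes>\<^sub>M M) (\<lambda>z. p (snd z))"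
    using assms by (auto intro: simple_function_comp[OF measurable_fst] simple_function_comp[OF measurable_snd])
  then show ?thesis
    by (rule simple_function_compose2)
qed

lemma simple_function_bounded:
  fixes v :: "'a \<Rightarrow> real"
  assumes "simple_function M v"
  obtains B where "0 \<le> B" "\<And>x. x \<in> space M \<Longrightarrow> \<bar>v x\<bar> \<le> B"
proof
  let ?B = "Max (insert 0 ((\<lambda>x. \<bar>v x\<bar>) ` space M))"
  have fin: "finite ((\<lambda>x. \<bar>v x\<bar>) ` space M)"
    using simple_functionD(1)[OF assms] by (simp flip: image_image)
  then show "0 \<le> ?B" by simp
  show "\<bar>v x\<bar> \<le> ?B" if "x \<in> space M" for x
    using fin that by (intro Max_ge) auto
qed

lemma (in finite_measure) integrable_simple_function:
  fixes f :: "'a \<Rightarrow> real"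
  assumes "simple_function M f"
  shows "integrable M f"
proof -
  obtain B where "\<And>x. x \<in> space M \<Longrightarrow> \<bar>f x\<bar> \<le> B"
    using simple_function_bounded[OF assms] by blast
  then show ?thesis
    using borel_measurable_simple_function[OF assms]
    by (intro integrable_const_bound[where B=B] AE_I2) auto
qed

context prob_space
begin

interpretation P: pair_prob_space M M ..

lemma integrable_step:
  "simple_function M p \<Longrightarrow> integrable (M \<Otimes>\<^sub>M M) (\<lambda>z. S (p (fst z)) (p (snd z)) :: real)"
  by (intro P.integrable_simple_function simple_function_step)

lemma step_approximable_step:
  fixes p :: "'a \<Rightarrow> nat"
  assumes "simple_function M p"
    and "\<And>x y. x \<in> space M \<Longrightarrow> y \<in> space M \<Longrightarrow> h (x, y) = S (p x) (p y)"
  shows "step_approximable M h"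
proof -
  have "(\<integral>z. \<bar>h z - S (p (fst z)) (p (snd z))\<bar> \<partial>(M \<Otimes>\<^sub>M M)) = (\<integral>z. 0 \<partial>(M \<Otimes>\<^sub>M M))"
    using assms(2) by (intro Bochner_Integration.integral_cong) (auto simp: space_pair_measure)
  then show ?thesis
    unfolding step_approximable_def using assms(1)
    by (intro allI impI exI[of _ p] exI[of _ S] conjI) simp_all
qed

text \<open>Both step functions live on the common refinement of their partitions, and the errors
  add up.\<close>

lemma step_approximable_add:
  assumes h: "integrable (M \<Otimes>\<^sub>M M) h" "step_approximable M h"
    and h': "integrable (M \<Otimes>\<^sub>M M) h'" "step_approximable M h'"
  shows "step_approximable M (\<lambda>z. h z + h' z)"
  unfolding step_approximable_def
proof (intro allI impI)
  fix e :: real assume "e > 0"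
  then have "e / 2 > 0" by simp
  obtain p :: "'a \<Rightarrow> nat" and S where p: "simple_function M p"
      "(\<integral>z. \<bar>h z - S (p (fst z)) (p (snd z))\<bar> \<partial>(M \<Otimes>\<^sub>M M)) < e / 2"
    by (rule step_approximableE[OF h(2) \<open>e / 2 > 0\<close>])
  obtain q :: "'a \<Rightarrow> nat" and T where q: "simple_function M q"
      "(\<integral>z. \<bar>h' z - T (q (fst z)) (q (snd z))\<bar> \<partial>(M \<Otimes>\<^sub>M M)) < e / 2"
    by (rule step_approximableE[OF h'(2) \<open>e / 2 > 0\<close>])
  let ?s = "\<lambda>z. S (p (fst z)) (p (snd z))" and ?t = "\<lambda>z. T (q (fst z)) (q (snd z))"
  \<comment> \<open>Pairs of labels, coded as single numbers, label the common refinement.\<close>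
  define r where "r = (\<lambda>x. prod_encode (p x, q x))"
  define R where "R = (\<lambda>i j. S (fst (prod_decode i)) (fst (prod_decode j)) +
                             T (snd (prod_decode i)) (snd (prod_decode j)))"
  note [simp] = integrable_step[OF p(1), of S] integrable_step[OF q(1), of T] h(1) h'(1)
  have "(\<integral>z. \<bar>h z + h' z - (?s z + ?t z)\<bar> \<partial>(M \<Otimes>\<^sub>M M)) \<le>
      (\<integral>z. \<bar>h z - ?s z\<bar> + \<bar>h' z - ?t z\<bar> \<partial>(M \<Otimes>\<^sub>M M))"
    by (intro integral_mono) auto
  also have "\<dots> = (\<integral>z. \<bar>h z - ?s z\<bar> \<partial>(M \<Otimes>\<^sub>M M)) + (\<integral>z. \<bar>h' z - ?t z\<bar> \<partial>(M \<Otimes>\<^sub>M M))"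
    by (intro Bochner_Integration.integral_add) auto
  also have "\<dots> < e" using p(2) q(2) by simp
  finally have "(\<integral>z. \<bar>h z + h' z - R (r (fst z)) (r (snd z))\<bar> \<partial>(M \<Otimes>\<^sub>M M)) < e"
    by (simp add: R_def r_def)
  moreover have "simple_function M r"
    unfolding r_def by (rule simple_function_compose2[OF p(1) q(1)])
  ultimately show "\<exists>(p :: 'a \<Rightarrow> nat) S. simple_function M p \<and>
      (\<integral>z. \<bar>h z + h' z - S (p (fst z)) (p (snd z))\<bar> \<partial>(M \<Otimes>\<^sub>M M)) < e"
    by (intro exI[of _ r] exI[of _ R] conjI)
qed

lemma step_approximable_cmult:
  assumes "step_approximable M h"
  shows "step_approximable M (\<lambda>z. c * h z)"
  unfolding step_approximable_def
proof (intro allI impI)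
  fix e :: real assume e: "e > 0"
  then have "e / (\<bar>c\<bar> + 1) > 0" by simp
  obtain p :: "'a \<Rightarrow> nat" and S where p: "simple_function M p"
      "(\<integral>z. \<bar>h z - S (p (fst z)) (p (snd z))\<bar> \<partial>(M \<Otimes>\<^sub>M M)) < e / (\<bar>c\<bar> + 1)"
    by (rule step_approximableE[OF assms \<open>e / (\<bar>c\<bar> + 1) > 0\<close>])
  let ?I = "\<integral>z. \<bar>h z - S (p (fst z)) (p (snd z))\<bar> \<partial>(M \<Otimes>\<^sub>M M)"
  have "0 \<le> ?I" by simp
  then have "\<bar>c\<bar> * ?I \<le> (\<bar>c\<bar> + 1) * ?I" by (intro mult_right_mono) auto
  also have "\<dots> < e" using p(2) by (simp add: field_simps)
  finally have "(\<integral>z. \<bar>c * h z - c * S (p (fst z)) (p (snd z))\<bar> \<partial>(M \<Otimes>\<^sub>M M)) < e"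
    by (simp add: abs_mult flip: right_diff_distrib)
  with p(1) show "\<exists>(p :: 'a \<Rightarrow> nat) S. simple_function M p \<and>
      (\<integral>z. \<bar>c * h z - S (p (fst z)) (p (snd z))\<bar> \<partial>(M \<Otimes>\<^sub>M M)) < e"
    by (intro exI[of _ p] exI[of _ "\<lambda>i j. c * S i j"]) simp
qed

lemma step_approximable_sum:
  fixes h :: "'i \<Rightarrow> 'a \<times> 'a \<Rightarrow> real"
  assumes "finite I" "\<And>i. i \<in> I \<Longrightarrow> integrable (M \<Otimes>\<^sub>M M) (h i)"
    and "\<And>i. i \<in> I \<Longrightarrow> step_approximable M (h i)"
  shows "step_approximable M (\<lambda>z. \<Sum>i\<in>I. h i z)"
  using assms
proof (induction I rule: finite_induct)
  case empty
  show ?case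
    by (simp, rule step_approximable_step[where p="\<lambda>_. 0" and S="\<lambda>_ _. 0"]) auto
next
  case (insert i I)
  then show ?case by (simp add: step_approximable_add)
qed

text \<open>Dominated convergence turns the pointwise limit into convergence in \<open>L^1\<close>;
  a member \<open>s i\<close> within \<open>e / 2\<close> of \<open>h\<close> is then replaced by
  its own step approximation.\<close>

lemma step_approximable_limit:
  fixes h :: "'a \<times> 'a \<Rightarrow> real"
  assumes int: "\<And>i. integrable (M \<Otimes>\<^sub>M M) (s i)" and s: "\<And>i. step_approximable M (s i)"
    and lim: "\<And>z. z \<in> space (M \<Otimes>\<^sub>M M) \<Longrightarrow> (\<lambda>i. s i z) \<longlonglongrightarrow> h z"
    and bnd: "\<And>i z. z \<in> space (M \<Otimes>\<^sub>M M) \<Longrightarrow> \<bar>s i z\<bar> \<le> w z"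
    and h: "integrable (M \<Otimes>\<^sub>M M) h" and w: "integrable (M \<Otimes>\<^sub>M M) w"
  shows "step_approximable M h"
  unfolding step_approximable_def
proof (intro allI impI)
  fix e :: real assume "e > 0"
  then have "e / 2 > 0" by simp
  have "(\<lambda>i. \<integral>z. \<bar>h z - s i z\<bar> \<partial>(M \<Otimes>\<^sub>M M)) \<longlonglongrightarrow> (\<integral>z. 0 \<partial>(M \<Otimes>\<^sub>M M))"
  proof (rule integral_dominated_convergence[where w="\<lambda>z. \<bar>h z\<bar> + w z"])
    show "AE z in M \<Otimes>\<^sub>M M. (\<lambda>i. \<bar>h z - s i z\<bar>) \<longlonglongrightarrow> 0"
    proof (rule AE_I2)
      fix z assume "z \<in> space (M \<Otimes>\<^sub>M M)"
      from tendsto_diff[OF tendsto_const lim[OF this], of "h z"]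
      show "(\<lambda>i. \<bar>h z - s i z\<bar>) \<longlonglongrightarrow> 0"
        by (auto intro: tendsto_rabs_zero)
    qed
    show "AE z in M \<Otimes>\<^sub>M M. norm \<bar>h z - s i z\<bar> \<le> \<bar>h z\<bar> + w z" for i
    proof (rule AE_I2)
      fix z assume "z \<in> space (M \<Otimes>\<^sub>M M)"
      from bnd[OF this, of i] show "norm \<bar>h z - s i z\<bar> \<le> \<bar>h z\<bar> + w z" by simp
    qed
  qed (use int h w in auto)
  then have "(\<lambda>i. \<integral>z. \<bar>h z - s i z\<bar> \<partial>(M \<Otimes>\<^sub>M M)) \<longlonglongrightarrow> 0" by simp
  from order_tendstoD(2)[OF this \<open>e / 2 > 0\<close>]
  obtain i where i: "(\<integral>z. \<bar>h z - s i z\<bar> \<partial>(M \<Otimes>\<^sub>M M)) < e / 2"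
    by (auto simp: eventually_sequentially)
  obtain p :: "'a \<Rightarrow> nat" and S where p: "simple_function M p"
      "(\<integral>z. \<bar>s i z - S (p (fst z)) (p (snd z))\<bar> \<partial>(M \<Otimes>\<^sub>M M)) < e / 2"
    by (rule step_approximableE[OF s[of i] \<open>e / 2 > 0\<close>])
  let ?t = "\<lambda>z. S (p (fst z)) (p (snd z))"
  note [simp] = integrable_step[OF p(1), of S] h int
  have "(\<integral>z. \<bar>h z - ?t z\<bar> \<partial>(M \<Otimes>\<^sub>M M)) \<le> (\<integral>z. \<bar>h z - s i z\<bar> + \<bar>s i z - ?t z\<bar> \<partial>(M \<Otimes>\<^sub>M M))"
    by (intro integral_mono) auto
  also have "\<dots> = (\<integral>z. \<bar>h z - s i z\<bar> \<partial>(M \<Otimes>\<^sub>M M)) + (\<integral>z. \<bar>s i z - ?t z\<bar> \<partial>(M \<Otimes>\<^sub>M M))"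
    by (intro Bochner_Integration.integral_add) auto
  also have "\<dots> < e" using i p(2) by simp
  finally show "\<exists>(p :: 'a \<Rightarrow> nat) S. simple_function M p \<and>
      (\<integral>z. \<bar>h z - S (p (fst z)) (p (snd z))\<bar> \<partial>(M \<Otimes>\<^sub>M M)) < e"
    using p(1) by (intro exI[of _ p] exI[of _ S] conjI)
qed

section \<open>Density of step functions\<close>

lemma integrable_pair_indicator:
  "A \<in> sets (M \<Otimes>\<^sub>M M) \<Longrightarrow> integrable (M \<Otimes>\<^sub>M M) (indicator A :: _ \<Rightarrow> real)"
  by (rule P.integrable_const_bound[where B=1]) (auto simp: indicator_def)

text \<open>Rectangles form an intersection-stable generator of the product sigma-algebra, so
  closure under complements and countable disjoint unions suffices.\<close>

lemma step_approximable_indicator: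
  assumes "A \<in> sets (M \<Otimes>\<^sub>M M)"
  shows "step_approximable M (indicator A)"
  using Int_stable_pair_measure_generator pair_measure_closed assms
  unfolding sets_pair_measure
proof (induct rule: sigma_sets_induct_disjoint)
  case (basic A)
  then obtain a b where A: "A = a \<times> b" "a \<in> sets M" "b \<in> sets M" by blast
  \<comment> \<open>The labels 0 to 3 stand for the four cells cut out by \<open>a\<close> and
    \<open>b\<close>: \<open>p x \<ge> 2\<close> tests membership in \<open>a\<close>, the parity of
    \<open>p x\<close> membership in \<open>b\<close>.\<close>
  define p :: "'a \<Rightarrow> nat" where "p = (\<lambda>x. 2 * indicator a x + indicator b x)"
  have "simple_function M p"
    unfolding p_def using A by (intro simple_function_compose2[where h="\<lambda>i j. 2 * i + j"]) auto
  moreover have "indicator A (x, y) = (if p x \<ge> 2 \<and> odd (p y) then 1 else 0 :: real)" for x y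
    by (auto simp: A p_def indicator_def)
  ultimately show ?case
    by (rule step_approximable_step[where S="\<lambda>i j. if i \<ge> 2 \<and> odd j then 1 else 0"])
next
  case empty
  show ?case
    by (rule step_approximable_step[where p="\<lambda>_. 0" and S="\<lambda>_ _. 0"]) auto
next
  case (compl A)
  have A: "A \<in> sets (M \<Otimes>\<^sub>M M)" using compl(1) by (simp add: sets_pair_measure)
  have 1: "step_approximable M (\<lambda>_. 1)"
    by (rule step_approximable_step[where p="\<lambda>_. 0" and S="\<lambda>_ _. 1"]) auto
  have *: "step_approximable M (\<lambda>z. 1 + (-1) * indicator A z)"
    using compl(2) A
    by (intro step_approximable_add 1 step_approximable_cmult) (auto intro: integrable_pair_indicator)
  have "space M \<times> space M - A \<in> sets (M \<Otimes>\<^sub>M M)"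
    using sets.compl_sets[OF A] by (simp add: space_pair_measure)
  \<comment> \<open>The function \<open>1 - indicator A\<close> agrees with the indicator of the
    complement only on the space. The limit lemma, applied to a constant sequence, passes from one
    to the other.\<close>
  then show ?case
    using A integrable_pair_indicator[OF A]
    by (intro step_approximable_limit[OF _ *, where w="\<lambda>_. 1"] integrable_pair_indicator)
      (auto simp: space_pair_measure split: split_indicator)
next
  case (union A)
  have A: "A i \<in> sets (M \<Otimes>\<^sub>M M)" for i using union(2) by (auto simp: sets_pair_measure)
  show ?case
  proof (rule step_approximable_limit[where w="\<lambda>_. 1" and s="\<lambda>N z. \<Sum>i<N. indicator (A i) z"])
    fix N
    show "integrable (M \<Otimes>\<^sub>M M) (\<lambda>z. \<Sum>i<N. indicator (A i) z :: real)"
      using A by (intro Bochner_Integration.integrable_sum integrable_pair_indicator)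
    show "step_approximable M (\<lambda>z. \<Sum>i<N. indicator (A i) z)"
      using A union(3) by (intro step_approximable_sum integrable_pair_indicator) auto
    have eq: "(\<Sum>i<N. indicator (A i) z) = (indicator (\<Union>i<N. A i) z :: real)" for N z
      using union(1) by (intro indicator_UN_disjoint[symmetric])
        (auto simp: disjoint_family_on_def)
    show "\<bar>\<Sum>i<N. indicator (A i) z\<bar> \<le> (1::real)" for z
      unfolding eq by (simp add: indicator_def)
    show "(\<lambda>N. \<Sum>i<N. indicator (A i) z) \<longlonglongrightarrow> (indicator (\<Union>i. A i) z :: real)" for z
      unfolding eq by (rule LIMSEQ_indicator_UN)
    show "integrable (M \<Otimes>\<^sub>M M) (indicator (\<Union>i. A i) :: _ \<Rightarrow> real)"
      using A by (intro integrable_pair_indicator) auto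
  qed simp
qed

text \<open>Standard induction on integrable functions: multiples of indicators, sums, and limits
  dominated by \<open>2 * norm (f z)\<close>.\<close>

lemma step_approximable_integrable:
  assumes "integrable (M \<Otimes>\<^sub>M M) h"
  shows "step_approximable M h"
  using assms
proof (induct rule: integrable_induct)
  case (base A c)
  then show ?case
    using step_approximable_cmult[OF step_approximable_indicator, of A c]
    by (simp add: mult.commute)
next
  case (add f g)
  then show ?case by (intro step_approximable_add)
next
  case (lim f s)
  show ?case
  proof (rule step_approximable_limit[OF lim(1) lim(2) lim(3) _ lim(5)])
    show "\<bar>s i z\<bar> \<le> 2 * norm (f z)" if "z \<in> space (M \<Otimes>\<^sub>M M)" for i z
      using lim(4)[OF that] by simp
    show "integrable (M \<Otimes>\<^sub>M M) (\<lambda>z. 2 * norm (f z))"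
      using lim(5) by simp
  qed
qed

end

subsection \<open>Operators on square-integrable functions\<close>

lemma L2_measurable [measurable_dest]: "f \<in> L2 M \<Longrightarrow> f \<in> borel_measurable M"
  by (simp add: L2_def)

lemma L2_integrable_square: "f \<in> L2 M \<Longrightarrow> integrable M (\<lambda>x. (f x)\<^sup>2)"
  by (simp add: L2_def)

lemma L2_integrable_mult:
  assumes f: "f \<in> L2 M" and g: "g \<in> L2 M"
  shows "integrable M (\<lambda>x. f x * g x)"
proof (rule Bochner_Integration.integrable_bound)
  show "integrable M (\<lambda>x. (f x)\<^sup>2 + (g x)\<^sup>2)"
    using f g by (simp add: L2_integrable_square)
  show "(\<lambda>x. f x * g x) \<in> borel_measurable M"
    using f g by measurable
  have "\<bar>f x * g x\<bar> \<le> (f x)\<^sup>2 + (g x)\<^sup>2" for x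
  proof -
    have "2 * (\<bar>f x\<bar> * \<bar>g x\<bar>) \<le> (f x)\<^sup>2 + (g x)\<^sup>2"
      using sum_squares_bound[of "\<bar>f x\<bar>" "\<bar>g x\<bar>"] by simp
    moreover have "0 \<le> \<bar>f x\<bar> * \<bar>g x\<bar>" by simp
    ultimately have "\<bar>f x\<bar> * \<bar>g x\<bar> \<le> (f x)\<^sup>2 + (g x)\<^sup>2" by linarith
    then show ?thesis by (simp add: abs_mult)
  qed
  then show "AE x in M. norm (f x * g x) \<le> norm ((f x)\<^sup>2 + (g x)\<^sup>2)"
    by (intro AE_I2) simp
qed

lemma L2_mult_bounded:
  assumes f: "f \<in> L2 M" and v: "v \<in> borel_measurable M"
    and B: "\<And>x. x \<in> space M \<Longrightarrow> \<bar>v x\<bar> \<le> B"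
  shows "(\<lambda>x. f x * v x) \<in> L2 M"
proof -
  have "integrable M (\<lambda>x. (f x * v x)\<^sup>2)"
  proof (rule Bochner_Integration.integrable_bound)
    show "integrable M (\<lambda>x. B\<^sup>2 * (f x)\<^sup>2)"
      using f by (simp add: L2_integrable_square)
    show "(\<lambda>x. (f x * v x)\<^sup>2) \<in> borel_measurable M"
      using f v by measurable
    show "AE x in M. norm ((f x * v x)\<^sup>2) \<le> norm (B\<^sup>2 * (f x)\<^sup>2)"
    proof (rule AE_I2)
      fix x assume "x \<in> space M"
      from power_mono[OF B[OF this], of 2] have "(v x)\<^sup>2 \<le> B\<^sup>2" by simp
      then have "(f x)\<^sup>2 * (v x)\<^sup>2 \<le> (f x)\<^sup>2 * B\<^sup>2"
        by (rule mult_left_mono) simp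
      then show "norm ((f x * v x)\<^sup>2) \<le> norm (B\<^sup>2 * (f x)\<^sup>2)"
        by (simp add: power_mult_distrib mult.commute abs_mult)
    qed
  qed
  moreover have "(\<lambda>x. f x * v x) \<in> borel_measurable M"
    using f v by measurable
  ultimately show ?thesis
    by (simp add: L2_def)
qed

lemma L2_cmult: "f \<in> L2 M \<Longrightarrow> (\<lambda>x. c * f x) \<in> L2 M"
  using L2_mult_bounded[of f M "\<lambda>_. c" "\<bar>c\<bar>"] by (simp add: mult.commute)

lemma L2_inner_self_nonneg: "0 \<le> L2_inner M f f"
  by (simp add: L2_inner_def)

lemma L2_inner_cmult: "L2_inner M (\<lambda>x. c * f x) (\<lambda>x. c * f x) = c\<^sup>2 * L2_inner M f f"
proof -
  have "(\<integral>x. c * f x * (c * f x) \<partial>M) = (\<integral>x. c\<^sup>2 * (f x * f x) \<partial>M)"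
    by (simp add: power2_eq_square mult_ac)
  then show ?thesis by (simp add: L2_inner_def)
qed

lemma L2_inner_cong_AE:
  assumes "f \<in> L2 M" "f' \<in> L2 M" "AE x in M. f x = f' x"
  shows "L2_inner M f f = L2_inner M f' f'"
  unfolding L2_inner_def
proof (rule integral_cong_AE)
  show "(\<lambda>x. f x * f x) \<in> borel_measurable M" "(\<lambda>x. f' x * f' x) \<in> borel_measurable M"
    using assms(1,2) by measurable
  show "AE x in M. f x * f x = f' x * f' x"
    using assms(3) by eventually_elim simp
qed

text \<open>The quadratic form is the integral of the square of a linear combination.
  Cauchy--Schwarz for kernels thereby yields Cauchy--Schwarz for \<open>L2_inner\<close>.\<close>

lemma psd_kernel_L2_inner: "psd_kernel (L2 M) (L2_inner M)"
  unfolding psd_kernel_def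
proof (intro conjI ballI allI impI)
  fix f g show "L2_inner M f g = L2_inner M g f"
    by (simp add: L2_inner_def mult.commute)
next
  fix F and c :: "('a \<Rightarrow> real) \<Rightarrow> real" assume F: "finite F \<and> F \<subseteq> L2 M"
  have int: "integrable M (\<lambda>x. c f * c g * (f x * g x))" if "f \<in> F" "g \<in> F" for f g
    using that F by (intro integrable_mult_right L2_integrable_mult) auto
  have "0 \<le> (\<integral>x. (\<Sum>f\<in>F. c f * f x)\<^sup>2 \<partial>M)" by simp
  also have "\<dots> = (\<integral>x. (\<Sum>f\<in>F. \<Sum>g\<in>F. c f * c g * (f x * g x)) \<partial>M)"
    by (simp add: power2_eq_square sum_product mult_ac)
  also have "\<dots> = (\<Sum>f\<in>F. \<Sum>g\<in>F. \<integral>x. c f * c g * (f x * g x) \<partial>M)"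
  proof (subst Bochner_Integration.integral_sum)
    show "integrable M (\<lambda>x. \<Sum>g\<in>F. c f * c g * (f x * g x))" if "f \<in> F" for f
      using int that by (intro Bochner_Integration.integrable_sum)
    show "(\<Sum>f\<in>F. \<integral>x. (\<Sum>g\<in>F. c f * c g * (f x * g x)) \<partial>M) =
        (\<Sum>f\<in>F. \<Sum>g\<in>F. \<integral>x. c f * c g * (f x * g x) \<partial>M)"
      using int by (intro sum.cong refl Bochner_Integration.integral_sum)
  qed
  also have "\<dots> = (\<Sum>f\<in>F. \<Sum>g\<in>F. c f * c g * L2_inner M f g)"
    by (simp add: L2_inner_def)
  finally show "0 \<le> \<dots>" .
qed

lemma L2_Cauchy_Schwarz:
  assumes "f \<in> L2 M" "g \<in> L2 M"
  shows "\<bar>L2_inner M f g\<bar> \<le> sqrt (L2_inner M f f) * sqrt (L2_inner M g g)"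
proof -
  have "\<bar>L2_inner M f g\<bar> = sqrt ((L2_inner M f g)\<^sup>2)" by simp
  also have "\<dots> \<le> sqrt (L2_inner M f f * L2_inner M g g)"
    by (intro real_sqrt_le_mono psd_kernel_Cauchy_Schwarz[OF psd_kernel_L2_inner] assms)
  finally show ?thesis by (simp add: real_sqrt_mult)
qed

section \<open>Operator norm estimates\<close>

text \<open>The norm sees unit vectors only, so \<open>f\<close> is rescaled. Since \<open>T\<close>
  is homogeneous only up to null sets, scaling is expressed through inner products. Functions of
  norm 0 cannot be rescaled; they vanish almost everywhere, and \<open>T\<close> respects
  this.\<close>

lemma L2_opnorm_bound:
  assumes T: "L2_linear_operator M T" and K: "L2_opnorm M T \<le> ennreal \<kappa>" "0 \<le> \<kappa>"
    and f: "f \<in> L2 M"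
  shows "sqrt (L2_inner M (T f) (T f)) \<le> \<kappa> * sqrt (L2_inner M f f)"
proof -
  have TL: "T g \<in> L2 M" if "g \<in> L2 M" for g
    using T that by (simp add: L2_linear_operator_def)
  have Tc: "AE x in M. T (\<lambda>y. c * f y) x = c * T f x" for c
    using T f by (simp add: L2_linear_operator_def)
  have Tcong: "AE x in M. T g x = T h x" if "g \<in> L2 M" "h \<in> L2 M" "AE x in M. g x = h x" for g h
    using T that by (simp add: L2_linear_operator_def)
  have scaled: "L2_inner M (T (\<lambda>y. c * f y)) (T (\<lambda>y. c * f y)) = c\<^sup>2 * L2_inner M (T f) (T f)" for c
    using L2_inner_cong_AE[OF TL[OF L2_cmult[OF f]] L2_cmult[OF TL[OF f]] Tc[of c]]
    by (simp add: L2_inner_cmult)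
  define n where "n = sqrt (L2_inner M f f)"
  show ?thesis
  proof (cases "n = 0")
    case True
    then have "(\<integral>x. (f x)\<^sup>2 \<partial>M) = 0"
      using L2_inner_self_nonneg[of M f] by (simp add: n_def L2_inner_def power2_eq_square)
    then have "AE x in M. f x = 0"
      using integral_nonneg_eq_0_iff_AE[OF L2_integrable_square[OF f]] by simp
    \<comment> \<open>Zero is written as \<open>0 * f x\<close> so that \<open>scaled\<close> with
      factor 0 gives the norm of \<open>T f\<close>.\<close>
    then have "AE x in M. f x = 0 * f x" by simp
    then have "AE x in M. T f x = T (\<lambda>y. 0 * f y) x"
      by (rule Tcong[OF f L2_cmult[OF f]])
    from L2_inner_cong_AE[OF TL[OF f] TL[OF L2_cmult[OF f]] this] scaled[of 0]
    show ?thesis using True by (simp add: n_def)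
  next
    case False
    then have n: "n > 0" using L2_inner_self_nonneg[of M f] by (simp add: n_def)
    let ?g = "\<lambda>y. (1 / n) * f y"
    have g: "?g \<in> L2 M" by (rule L2_cmult[OF f])
    have "L2_inner M ?g ?g = (1 / n)\<^sup>2 * L2_inner M f f" by (rule L2_inner_cmult)
    also have "L2_inner M f f = n\<^sup>2" by (simp add: n_def L2_inner_self_nonneg)
    finally have "L2_inner M ?g ?g = 1" using n by (simp add: power_divide)
    then have "L2_norm M ?g = 1" using g by (simp add: L2_norm_def)
    then have "L2_norm M (T ?g) \<le> L2_opnorm M T"
      unfolding L2_opnorm_def using g by (intro SUP_upper) simp
    also have "\<dots> \<le> ennreal \<kappa>" by (rule K)
    finally have "ennreal (sqrt (L2_inner M (T ?g) (T ?g))) \<le> ennreal \<kappa>"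
      using TL[OF g] by (simp add: L2_norm_def)
    then have "sqrt (L2_inner M (T ?g) (T ?g)) \<le> \<kappa>"
      using K(2) by (simp add: ennreal_le_iff)
    then have "sqrt (L2_inner M (T f) (T f)) / n \<le> \<kappa>"
      using n unfolding scaled by (simp add: real_sqrt_mult real_sqrt_divide power_divide)
    then show ?thesis
      using n by (simp add: divide_le_eq flip: n_def)
  qed
qed

text \<open>In this form the operator norm of the second factor enters the Schur product
  estimates.\<close>

lemma L2_opnorm_form_bound:
  assumes T: "L2_linear_operator M T" and K: "L2_opnorm M T \<le> ennreal \<kappa>" "0 \<le> \<kappa>"
    and u: "u \<in> L2 M" and w: "w \<in> L2 M"
  shows "\<bar>L2_inner M u (T w)\<bar> \<le> \<kappa> * (sqrt (L2_inner M u u) * sqrt (L2_inner M w w))"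
proof -
  have Tw: "T w \<in> L2 M" using T w by (simp add: L2_linear_operator_def)
  have "\<bar>L2_inner M u (T w)\<bar> \<le> sqrt (L2_inner M u u) * sqrt (L2_inner M (T w) (T w))"
    by (rule L2_Cauchy_Schwarz[OF u Tw])
  also have "\<dots> \<le> sqrt (L2_inner M u u) * (\<kappa> * sqrt (L2_inner M w w))"
    by (rule mult_left_mono[OF L2_opnorm_bound[OF T K w]]) (simp add: L2_inner_self_nonneg)
  finally show ?thesis by (simp add: mult_ac)
qed

lemma (in sigma_finite_measure) borel_measurable_integral_op:
  assumes [measurable]: "(\<lambda>(x, y). k x y) \<in> borel_measurable (M \<Otimes>\<^sub>M M)" "f \<in> borel_measurable M"
  shows "integral_op M k f \<in> borel_measurable M"
  unfolding integral_op_def[abs_def] by measurable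

text \<open>Linearity and compatibility with equality almost everywhere come from the integral
  formula. What remains to be checked is measurability, existence of the defining integrals, and the
  range.\<close>

lemma (in sigma_finite_measure) L2_integral_operatorI:
  assumes k: "(\<lambda>(x, y). k x y) \<in> borel_measurable (M \<Otimes>\<^sub>M M)"
    and int: "\<And>f. f \<in> L2 M \<Longrightarrow> AE x in M. integrable M (\<lambda>y. k x y * f y)"
    and L2: "\<And>f. f \<in> L2 M \<Longrightarrow> integral_op M k f \<in> L2 M"
  shows "L2_integral_operator M k"
  unfolding L2_integral_operator_def L2_linear_operator_def
proof (intro conjI ballI allI impI k int L2)
  have k': "k x \<in> borel_measurable M" if "x \<in> space M" for x
    using measurable_compose[OF measurable_Pair1'[OF that] k] by simp
  fix f g assume f: "f \<in> L2 M" and g: "g \<in> L2 M"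
  show "AE x in M. integral_op M k f x = integral_op M k g x" if ae: "AE x in M. f x = g x"
  proof (rule AE_I2)
    fix x assume "x \<in> space M"
    note [measurable] = k'[OF this] f g
    show "integral_op M k f x = integral_op M k g x"
      unfolding integral_op_def
    proof (rule integral_cong_AE)
      show "(\<lambda>y. k x y * f y) \<in> borel_measurable M" "(\<lambda>y. k x y * g y) \<in> borel_measurable M"
        by measurable
      show "AE y in M. k x y * f y = k x y * g y"
        using ae by eventually_elim simp
    qed
  qed
  show "AE x in M. integral_op M k (\<lambda>y. f y + g y) x = integral_op M k f x + integral_op M k g x"
    using int[OF f] int[OF g] by eventually_elim (simp add: integral_op_def distrib_left)
next
  fix f c assume "f \<in> L2 M"
  show "AE x in M. integral_op M k (\<lambda>y. c * f y) x = c * integral_op M k f x"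
    by (simp add: integral_op_def mult.left_commute)
qed

lemma L2_opnorm_leI:
  assumes "\<And>f. f \<in> L2 M \<Longrightarrow> T f \<in> L2 M" "0 \<le> c"
    and "\<And>f. f \<in> L2 M \<Longrightarrow> L2_inner M (T f) (T f) \<le> c\<^sup>2 * L2_inner M f f"
  shows "L2_opnorm M T \<le> ennreal c"
  unfolding L2_opnorm_def
proof (rule SUP_least, clarify)
  fix f assume f: "f \<in> L2 M" "L2_norm M f = 1"
  then have "L2_inner M f f = 1"
    using L2_inner_self_nonneg[of M f] by (simp add: L2_norm_def)
  then have "L2_inner M (T f) (T f) \<le> c\<^sup>2"
    using assms(3)[OF f(1)] by simp
  from real_sqrt_le_mono[OF this] show "L2_norm M (T f) \<le> ennreal c"
    using assms(1)[OF f(1)] assms(2) by (simp add: L2_norm_def ennreal_leI)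
qed

subsection \<open>Schur products of integral operators\<close>

context prob_space
begin

interpretation P: pair_prob_space M M ..

text \<open>Fubini's theorem. It moves the form to the product space, where kernels are approximated
  in \<open>L^1\<close>.\<close>

lemma integral_op_form_eq:
  assumes "integrable (M \<Otimes>\<^sub>M M) (\<lambda>z. g (fst z) * k (fst z) (snd z) * f (snd z))"
  shows "(\<integral>z. g (fst z) * k (fst z) (snd z) * f (snd z) \<partial>(M \<Otimes>\<^sub>M M)) =
    L2_inner M g (integral_op M k f)"
  using P.integral_fst'[OF assms]
  by (simp add: L2_inner_def integral_op_def mult.assoc)

lemma borel_measurable_form:
  assumes k: "(\<lambda>(x, y). k x y) \<in> borel_measurable (M \<Otimes>\<^sub>M M)"
    and gf: "g \<in> borel_measurable M" "f \<in> borel_measurable M"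
  shows "(\<lambda>z. g (fst z) * k (fst z) (snd z) * f (snd z) :: real) \<in> borel_measurable (M \<Otimes>\<^sub>M M)"
proof -
  note [measurable] = k[unfolded case_prod_beta] gf
  show ?thesis by measurable
qed

section \<open>Schur product with a step kernel\<close>

text \<open>The Gram features \<open>w l\<close> of \<open>A\<close> are bounded, so
  \<open>g * w l\<close> and \<open>f * w l\<close> stay in \<open>L2 M\<close>, and the form splits
  into the forms of \<open>k\<close> at these functions. The bound \<open>N\<close> makes the pieces
  integrable on the product space; the final constant is independent of it.\<close>

lemma finite_rank_form_bound:
  fixes p :: "'a \<Rightarrow> nat"
  assumes p: "simple_function M p" and A: "psd_kernel (p ` space M) A"
    and diag: "\<And>i. i \<in> p ` space M \<Longrightarrow> A i i \<le> C"
    and f: "f \<in> L2 M" and g: "g \<in> L2 M"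
    and k: "(\<lambda>(x, y). k x y) \<in> borel_measurable (M \<Otimes>\<^sub>M M)"
    and bnd: "\<And>x y. x \<in> space M \<Longrightarrow> y \<in> space M \<Longrightarrow> \<bar>g x * k x y * f y\<bar> \<le> N"
    and op: "\<And>u w. u \<in> L2 M \<Longrightarrow> w \<in> L2 M \<Longrightarrow>
      \<bar>L2_inner M u (integral_op M k w)\<bar> \<le> \<kappa> * (sqrt (L2_inner M u u) * sqrt (L2_inner M w w))"
    and \<kappa>: "0 \<le> \<kappa>"
  shows "\<bar>\<integral>z. A (p (fst z)) (p (snd z)) * (g (fst z) * k (fst z) (snd z) * f (snd z)) \<partial>(M \<Otimes>\<^sub>M M)\<bar>
    \<le> \<kappa> * C * (sqrt (L2_inner M g g) * sqrt (L2_inner M f f))"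
proof -
  let ?n = "\<lambda>h. sqrt (L2_inner M h h)"
  obtain x0 where x0: "x0 \<in> space M" using not_empty by blast
  have C: "0 \<le> C"
    using psd_kernel_diag_nonneg[OF A, of "p x0"] diag[of "p x0"] x0 by force
  obtain n :: nat and v where v: "\<forall>i\<in>p ` space M. \<forall>j\<in>p ` space M. A i j = (\<Sum>l<n. v l i * v l j)"
    using psd_kernel_Gram[OF simple_functionD(1)[OF p] A] by blast
  define w where "w = (\<lambda>l x. v l (p x))"
  have w: "simple_function M (w l)" for l
    unfolding w_def by (rule simple_function_compose1[OF p])
  have wm: "w l \<in> borel_measurable M" for l
    by (rule borel_measurable_simple_function[OF w])
  have gram: "A (p x) (p y) = (\<Sum>l<n. w l x * w l y)" if "x \<in> space M" "y \<in> space M" for x y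
    using v that by (simp add: w_def)
  have wL2: "(\<lambda>x. h x * w l x) \<in> L2 M" if "h \<in> L2 M" for h l
  proof -
    obtain B where "\<And>x. x \<in> space M \<Longrightarrow> \<bar>w l x\<bar> \<le> B"
      using simple_function_bounded[OF w[of l]] by blast
    from L2_mult_bounded[OF that wm this] show ?thesis .
  qed
  define F where "F = (\<lambda>l z. g (fst z) * w l (fst z) * k (fst z) (snd z) * (f (snd z) * w l (snd z)))"
  have F: "integrable (M \<Otimes>\<^sub>M M) (F l)" for l
  proof -
    obtain B where B: "0 \<le> B" "\<And>x. x \<in> space M \<Longrightarrow> \<bar>w l x\<bar> \<le> B"
      using simple_function_bounded[OF w[of l]] by blast
    have "\<bar>F l z\<bar> \<le> N * (B * B)" if "z \<in> space (M \<Otimes>\<^sub>M M)" for z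
    proof -
      have z: "fst z \<in> space M" "snd z \<in> space M" using that by (auto simp: space_pair_measure)
      have "\<bar>F l z\<bar> = \<bar>g (fst z) * k (fst z) (snd z) * f (snd z)\<bar> * (\<bar>w l (fst z)\<bar> * \<bar>w l (snd z)\<bar>)"
        by (simp add: F_def abs_mult mult_ac)
      also have "\<dots> \<le> N * (B * B)"
        using bnd[OF z] B(2)[OF z(1)] B(2)[OF z(2)] B(1)
        by (intro mult_mono) (auto intro: order_trans[OF abs_ge_zero])
      finally show ?thesis .
    qed
    moreover have "F l \<in> borel_measurable (M \<Otimes>\<^sub>M M)"
      unfolding F_def using L2_measurable[OF wL2[OF g]] L2_measurable[OF wL2[OF f]]
      by (rule borel_measurable_form[OF k])
    ultimately show ?thesis
      by (intro P.integrable_const_bound[where B="N * (B * B)"] AE_I2) simp_all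
  qed
  have Fi: "integral\<^sup>L (M \<Otimes>\<^sub>M M) (F l) = L2_inner M (\<lambda>x. g x * w l x) (integral_op M k (\<lambda>x. f x * w l x))" for l
    unfolding F_def by (rule integral_op_form_eq) (use F[of l] in \<open>simp add: F_def\<close>)
  \<comment> \<open>At each point the squares of the features sum to \<open>A (p x) (p x)\<close>,
    which is at most \<open>C\<close>. The factors \<open>g\<close> and \<open>f\<close> later
    contribute \<open>sqrt C\<close> each.\<close>
  have sumn: "L2_set (\<lambda>l. ?n (\<lambda>x. h x * w l x)) {..<n} \<le> sqrt C * ?n h" if h: "h \<in> L2 M" for h
  proof -
    have "(\<Sum>l<n. L2_inner M (\<lambda>x. h x * w l x) (\<lambda>x. h x * w l x)) =
        (\<integral>x. (\<Sum>l<n. h x * w l x * (h x * w l x)) \<partial>M)"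
      unfolding L2_inner_def using wL2[OF h]
      by (intro Bochner_Integration.integral_sum[symmetric] L2_integrable_mult) auto
    also have "\<dots> \<le> (\<integral>x. C * (h x * h x) \<partial>M)"
    proof (rule integral_mono)
      show "integrable M (\<lambda>x. \<Sum>l<n. h x * w l x * (h x * w l x))"
        using wL2[OF h] by (intro Bochner_Integration.integrable_sum L2_integrable_mult) auto
      show "integrable M (\<lambda>x. C * (h x * h x))"
        using L2_integrable_mult[OF h h] by simp
      fix x assume x: "x \<in> space M"
      have "(\<Sum>l<n. h x * w l x * (h x * w l x)) = A (p x) (p x) * (h x * h x)"
        unfolding gram[OF x x] sum_distrib_right by (simp add: mult_ac)
      also have "\<dots> \<le> C * (h x * h x)"
        using diag[of "p x"] x by (intro mult_right_mono) auto
      finally show "(\<Sum>l<n. h x * w l x * (h x * w l x)) \<le> C * (h x * h x)" .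
    qed
    also have "\<dots> = C * L2_inner M h h" by (simp add: L2_inner_def)
    finally have "sqrt (\<Sum>l<n. L2_inner M (\<lambda>x. h x * w l x) (\<lambda>x. h x * w l x)) \<le> sqrt (C * L2_inner M h h)"
      by (rule real_sqrt_le_mono)
    then show ?thesis
      by (simp add: L2_set_def L2_inner_self_nonneg real_sqrt_mult)
  qed
  have "(\<integral>z. A (p (fst z)) (p (snd z)) * (g (fst z) * k (fst z) (snd z) * f (snd z)) \<partial>(M \<Otimes>\<^sub>M M)) =
      (\<integral>z. (\<Sum>l<n. F l z) \<partial>(M \<Otimes>\<^sub>M M))"
    by (intro Bochner_Integration.integral_cong refl)
      (auto simp: space_pair_measure gram F_def sum_distrib_right sum_distrib_left mult_ac)
  also have "\<dots> = (\<Sum>l<n. integral\<^sup>L (M \<Otimes>\<^sub>M M) (F l))"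
    by (intro Bochner_Integration.integral_sum F)
  also have "\<bar>\<dots>\<bar> \<le> (\<Sum>l<n. \<bar>integral\<^sup>L (M \<Otimes>\<^sub>M M) (F l)\<bar>)"
    by (rule sum_abs)
  also have "\<dots> \<le> (\<Sum>l<n. \<kappa> * (?n (\<lambda>x. g x * w l x) * ?n (\<lambda>x. f x * w l x)))"
    unfolding Fi by (intro sum_mono op wL2 f g)
  also have "\<dots> = \<kappa> * (\<Sum>l<n. \<bar>?n (\<lambda>x. g x * w l x)\<bar> * \<bar>?n (\<lambda>x. f x * w l x)\<bar>)"
    by (simp add: sum_distrib_left L2_inner_self_nonneg)
  also have "\<dots> \<le> \<kappa> * (L2_set (\<lambda>l. ?n (\<lambda>x. g x * w l x)) {..<n} * L2_set (\<lambda>l. ?n (\<lambda>x. f x * w l x)) {..<n})"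
    by (intro mult_left_mono L2_set_mult_ineq \<kappa>)
  also have "\<dots> \<le> \<kappa> * ((sqrt C * ?n g) * (sqrt C * ?n f))"
    by (intro mult_left_mono mult_mono sumn f g \<kappa>)
      (simp_all add: C L2_inner_self_nonneg)
  also have "\<dots> = \<kappa> * (sqrt C * sqrt C) * (?n g * ?n f)" by (simp only: mult_ac)
  also have "sqrt C * sqrt C = C" using C by simp
  finally show ?thesis .
qed

section \<open>Averaging a kernel over the cells of a partition\<close>

text \<open>The step function supplied by density need not be positive semi-definite, so it is
  replaced by the averages of \<open>k\<close> over its cells. Averaging preserves positivity and
  the bound \<open>C\<close>. It contracts the \<open>L^1\<close> norm and fixes step functions on
  the same partition almost everywhere, so the error at most doubles; hence the tolerance
  \<open>e / 2\<close>.\<close>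

lemma psd_step_approximation:
  assumes k: "(\<lambda>(x, y). k x y) \<in> borel_measurable (M \<Otimes>\<^sub>M M)"
    and C: "\<And>x y. x \<in> space M \<Longrightarrow> y \<in> space M \<Longrightarrow> \<bar>k x y\<bar> \<le> C"
    and sym: "\<And>x y. x \<in> space M \<Longrightarrow> y \<in> space M \<Longrightarrow> k x y = k y x"
    and psd: "\<And>h. h \<in> L2 M \<Longrightarrow> 0 \<le> L2_inner M h (integral_op M k h)"
    and e: "0 < e"
  obtains p :: "'a \<Rightarrow> nat" and A where "simple_function M p" "psd_kernel (p ` space M) A"
    "\<forall>i\<in>p ` space M. A i i \<le> C"
    "(\<integral>z. \<bar>k (fst z) (snd z) - A (p (fst z)) (p (snd z))\<bar> \<partial>(M \<Otimes>\<^sub>M M)) \<le> e"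
proof -
  obtain x0 where x0: "x0 \<in> space M" using not_empty by blast
  have C0: "0 \<le> C" using C[OF x0 x0] by linarith
  define h where "h = (\<lambda>z. k (fst z) (snd z))"
  have hm [measurable]: "h \<in> borel_measurable (M \<Otimes>\<^sub>M M)"
    using k by (simp add: h_def case_prod_beta')
  have hC: "\<bar>h z\<bar> \<le> C" if "z \<in> space (M \<Otimes>\<^sub>M M)" for z
    using C that by (auto simp: h_def space_pair_measure)
  have h: "integrable (M \<Otimes>\<^sub>M M) h"
    using hC by (intro P.integrable_const_bound[where B=C] AE_I2) auto
  from e have e2: "e / 2 > 0" by simp
  obtain p :: "'a \<Rightarrow> nat" and S where p: "simple_function M p"
      and S: "(\<integral>z. \<bar>h z - S (p (fst z)) (p (snd z))\<bar> \<partial>(M \<Otimes>\<^sub>M M)) < e / 2"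
    by (rule step_approximableE[OF step_approximable_integrable[OF h] e2])
  define s where "s = (\<lambda>z. S (p (fst z)) (p (snd z)))"
  have s: "integrable (M \<Otimes>\<^sub>M M) s"
    unfolding s_def by (rule integrable_step[OF p])
  define R where "R = p ` space M"
  have R: "finite R" unfolding R_def by (rule simple_functionD(1)[OF p])
  define X where "X = (\<lambda>i. {x \<in> space M. p x = i})"
  have X [measurable]: "X i \<in> sets M" for i
  proof -
    have "X i = p -` {i} \<inter> space M" by (auto simp: X_def)
    then show ?thesis using simple_functionD(2)[OF p] by simp
  qed
  define m where "m = (\<lambda>i. measure M (X i))"
  define c where "c = (\<lambda>i j z. indicator (X i) (fst z) * indicator (X j) (snd z) :: real)"
  have cm [measurable]: "c i j \<in> borel_measurable (M \<Otimes>\<^sub>M M)" for i j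
    unfolding c_def by measurable
  have c01: "0 \<le> c i j z" "\<bar>c i j z\<bar> \<le> 1" for i j z
    by (auto simp: c_def indicator_def)
  have ci: "integrable (M \<Otimes>\<^sub>M M) (\<lambda>z. c i j z * \<phi> z)" if "integrable (M \<Otimes>\<^sub>M M) \<phi>" for i j \<phi>
  proof (rule Bochner_Integration.integrable_bound[OF that])
    have "\<bar>c i j z\<bar> * \<bar>\<phi> z\<bar> \<le> 1 * \<bar>\<phi> z\<bar>" for z
      by (intro mult_right_mono c01) simp
    then show "AE z in M \<Otimes>\<^sub>M M. norm (c i j z * \<phi> z) \<le> norm (\<phi> z)"
      by (simp add: abs_mult)
  qed (use that in measurable)
  have c1: "integrable (M \<Otimes>\<^sub>M M) (c i j)" for i j
    using ci[of "\<lambda>_. 1"] by simp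
  have cI: "(\<integral>z. c i j z \<partial>(M \<Otimes>\<^sub>M M)) = m i * m j" for i j
    using P.integral_fst'[OF c1[of i j]] by (simp add: c_def m_def)
  \<comment> \<open>Each point of the product space lies in exactly one product of cells, so a
    single term survives.\<close>
  have dec: "\<phi> z = (\<Sum>i\<in>R. \<Sum>j\<in>R. c i j z * \<phi> z)" if "z \<in> space (M \<Otimes>\<^sub>M M)" for \<phi> :: "_ \<Rightarrow> real" and z
  proof -
    have z: "fst z \<in> space M" "snd z \<in> space M" using that by (auto simp: space_pair_measure)
    have eq: "c i j z * \<phi> z = (if j = p (snd z) then if i = p (fst z) then \<phi> z else 0 else 0)" for i j
      using z by (simp add: c_def X_def indicator_def)
    show ?thesis using z R unfolding eq by (simp add: R_def)
  qed
  have decI: "(\<integral>z. \<phi> z \<partial>(M \<Otimes>\<^sub>M M)) = (\<Sum>i\<in>R. \<Sum>j\<in>R. \<integral>z. c i j z * \<phi> z \<partial>(M \<Otimes>\<^sub>M M))"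
    if "integrable (M \<Otimes>\<^sub>M M) \<phi>" for \<phi> :: "_ \<Rightarrow> real"
  proof -
    have "(\<integral>z. \<phi> z \<partial>(M \<Otimes>\<^sub>M M)) = (\<integral>z. (\<Sum>i\<in>R. \<Sum>j\<in>R. c i j z * \<phi> z) \<partial>(M \<Otimes>\<^sub>M M))"
      using dec by (intro Bochner_Integration.integral_cong refl)
    also have "\<dots> = (\<Sum>i\<in>R. \<integral>z. (\<Sum>j\<in>R. c i j z * \<phi> z) \<partial>(M \<Otimes>\<^sub>M M))"
      by (intro Bochner_Integration.integral_sum Bochner_Integration.integrable_sum ci that)
    also have "\<dots> = (\<Sum>i\<in>R. \<Sum>j\<in>R. \<integral>z. c i j z * \<phi> z \<partial>(M \<Otimes>\<^sub>M M))"
      by (intro sum.cong refl Bochner_Integration.integral_sum ci that)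
    finally show ?thesis .
  qed
  \<comment> \<open>On null cells the average \<open>A i j\<close> is \<open>0\<close> because of \<open>x / 0 = 0\<close>; they contribute nothing.\<close>
  define I where "I = (\<lambda>i j. \<integral>z. c i j z * h z \<partial>(M \<Otimes>\<^sub>M M))"
  define A where "A = (\<lambda>i j. I i j / (m i * m j))"
  have Isym: "I i j = I j i" for i j
  proof -
    have "I i j = (\<integral>(x, y). c i j (y, x) * h (y, x) \<partial>(M \<Otimes>\<^sub>M M))"
      unfolding I_def by (rule P.integral_product_swap[symmetric]) measurable
    also have "\<dots> = I j i"
      unfolding I_def
      by (intro Bochner_Integration.integral_cong refl)
        (auto simp: space_pair_measure c_def h_def sym mult_ac)
    finally show ?thesis .
  qed
  have "psd_kernel R A"
    unfolding psd_kernel_def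
  proof (intro conjI ballI allI impI)
    show "A i j = A j i" for i j by (simp add: A_def Isym[of i j] mult.commute)
    fix F and a :: "nat \<Rightarrow> real" assume "finite F \<and> F \<subseteq> R"
    then have F: "finite F" by simp
    \<comment> \<open>The weights \<open>a i / m i\<close> turn the form of \<open>k\<close> at
      \<open>H\<close> into the form of \<open>A\<close> at \<open>a\<close>.\<close>
    define H where "H = (\<lambda>x. \<Sum>i\<in>F. a i / m i * indicator (X i) x)"
    have Hm [measurable]: "H \<in> borel_measurable M" unfolding H_def by measurable
    have Hb: "\<bar>H x\<bar> \<le> (\<Sum>i\<in>F. \<bar>a i / m i\<bar>)" for x
    proof -
      have "\<bar>H x\<bar> \<le> (\<Sum>i\<in>F. \<bar>a i / m i * indicator (X i) x\<bar>)"
        unfolding H_def by (rule sum_abs)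
      also have "\<dots> \<le> (\<Sum>i\<in>F. \<bar>a i / m i\<bar>)"
        by (intro sum_mono) (auto simp: indicator_def)
      finally show ?thesis .
    qed
    have one: "(\<lambda>_. 1) \<in> L2 M" by (simp add: L2_def)
    have HL2: "H \<in> L2 M"
      using L2_mult_bounded[OF one Hm Hb] by simp
    have eq: "H (fst z) * k (fst z) (snd z) * H (snd z) =
        (\<Sum>i\<in>F. \<Sum>j\<in>F. a i / m i * (a j / m j) * (c i j z * h z))" for z
    proof -
      have "H (fst z) * k (fst z) (snd z) * H (snd z) = H (fst z) * H (snd z) * h z"
        by (simp add: h_def)
      also have "\<dots> = (\<Sum>i\<in>F. \<Sum>j\<in>F. a i / m i * indicator (X i) (fst z) *
          (a j / m j * indicator (X j) (snd z)) * h z)"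
        unfolding H_def sum_product by (simp only: sum_distrib_right)
      also have "\<dots> = (\<Sum>i\<in>F. \<Sum>j\<in>F. a i / m i * (a j / m j) * (c i j z * h z))"
        by (intro sum.cong refl) (simp add: c_def)
      finally show ?thesis .
    qed
    have int: "integrable (M \<Otimes>\<^sub>M M) (\<lambda>z. a i / m i * (a j / m j) * (c i j z * h z))" for i j
      by (rule integrable_mult_right[OF ci[OF h]])
    have "0 \<le> L2_inner M H (integral_op M k H)" by (rule psd[OF HL2])
    also have "\<dots> = (\<integral>z. H (fst z) * k (fst z) (snd z) * H (snd z) \<partial>(M \<Otimes>\<^sub>M M))"
      by (rule integral_op_form_eq[symmetric])
        (unfold eq, intro Bochner_Integration.integrable_sum int)
    also have "\<dots> = (\<Sum>i\<in>F. \<integral>z. (\<Sum>j\<in>F. a i / m i * (a j / m j) * (c i j z * h z)) \<partial>(M \<Otimes>\<^sub>M M))"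
      unfolding eq by (intro Bochner_Integration.integral_sum Bochner_Integration.integrable_sum int)
    also have "\<dots> = (\<Sum>i\<in>F. \<Sum>j\<in>F. \<integral>z. a i / m i * (a j / m j) * (c i j z * h z) \<partial>(M \<Otimes>\<^sub>M M))"
      by (intro sum.cong refl Bochner_Integration.integral_sum int)
    also have "\<dots> = (\<Sum>i\<in>F. \<Sum>j\<in>F. a i * a j * A i j)"
      by (simp add: A_def I_def)
    finally show "0 \<le> \<dots>" .
  qed
  moreover have "A i i \<le> C" for i
  proof -
    have "I i i \<le> (\<integral>z. c i i z * C \<partial>(M \<Otimes>\<^sub>M M))"
      unfolding I_def
    proof (rule integral_mono)
      fix z assume "z \<in> space (M \<Otimes>\<^sub>M M)"
      from hC[OF this] show "c i i z * h z \<le> c i i z * C"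
        by (intro mult_left_mono c01) simp
    qed (use ci h c1 in auto)
    also have "\<dots> = C * (m i * m i)" by (simp add: cI mult_ac)
    \<comment> \<open>On a null cell the average is 0, which is where \<open>0 \<le> C\<close>
      enters.\<close>
    finally show ?thesis
      using C0 by (cases "m i = 0") (auto simp: A_def divide_le_eq mult_less_0_iff not_less zero_less_mult_iff m_def)
  qed
  moreover have "(\<integral>z. \<bar>k (fst z) (snd z) - A (p (fst z)) (p (snd z))\<bar> \<partial>(M \<Otimes>\<^sub>M M)) \<le> e"
  proof -
    define t where "t = (\<lambda>z. A (p (fst z)) (p (snd z)))"
    have t: "integrable (M \<Otimes>\<^sub>M M) t"
      unfolding t_def by (rule integrable_step[OF p])
    have hs: "integrable (M \<Otimes>\<^sub>M M) (\<lambda>z. \<bar>h z - s z\<bar>)" using h s by simp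
    have "(\<integral>z. \<bar>t z - s z\<bar> \<partial>(M \<Otimes>\<^sub>M M)) = (\<Sum>i\<in>R. \<Sum>j\<in>R. \<integral>z. c i j z * \<bar>t z - s z\<bar> \<partial>(M \<Otimes>\<^sub>M M))"
      by (rule decI) (use t s in simp)
    \<comment> \<open>The contraction property, cell by cell: on a cell of positive measure
      \<open>t - s\<close> is constant and equals the average of \<open>h - s\<close>.\<close>
    also have "\<dots> \<le> (\<Sum>i\<in>R. \<Sum>j\<in>R. \<integral>z. c i j z * \<bar>h z - s z\<bar> \<partial>(M \<Otimes>\<^sub>M M))"
    proof (intro sum_mono)
      fix i j
      have cell: "c i j z * \<phi> (p (fst z)) (p (snd z)) = c i j z * \<phi> i j" for z and \<phi> :: "nat \<Rightarrow> nat \<Rightarrow> real"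
        by (simp add: c_def X_def indicator_def)
      have "(\<integral>z. c i j z * \<bar>t z - s z\<bar> \<partial>(M \<Otimes>\<^sub>M M)) = (\<integral>z. c i j z * \<bar>A i j - S i j\<bar> \<partial>(M \<Otimes>\<^sub>M M))"
        unfolding t_def s_def by (simp only: cell[of _ "\<lambda>i j. \<bar>A i j - S i j\<bar>"])
      also have "\<dots> = m i * m j * \<bar>A i j - S i j\<bar>" by (simp add: cI)
      also have "\<dots> = \<bar>m i * m j * A i j - m i * m j * S i j\<bar>"
        unfolding right_diff_distrib[symmetric] by (simp add: abs_mult m_def)
      \<comment> \<open>For \<open>m i * m j = 0\<close> the left side is 0; otherwise both sides
        are equal.\<close>
      also have "\<dots> \<le> \<bar>I i j - m i * m j * S i j\<bar>"
        by (cases "m i * m j = 0") (auto simp: A_def)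
      also have "I i j - m i * m j * S i j = (\<integral>z. c i j z * (h z - s z) \<partial>(M \<Otimes>\<^sub>M M))"
      proof -
        have "m i * m j * S i j = (\<integral>z. c i j z * s z \<partial>(M \<Otimes>\<^sub>M M))"
          unfolding s_def cell[of _ S] by (simp add: cI)
        then show ?thesis
          unfolding I_def right_diff_distrib using ci[OF h] ci[OF s] by simp
      qed
      also have "\<bar>\<dots>\<bar> \<le> (\<integral>z. \<bar>c i j z * (h z - s z)\<bar> \<partial>(M \<Otimes>\<^sub>M M))"
        by (rule integral_abs_bound)
      also have "\<dots> = (\<integral>z. c i j z * \<bar>h z - s z\<bar> \<partial>(M \<Otimes>\<^sub>M M))"
        using c01(1) by (simp add: abs_mult)
      finally show "(\<integral>z. c i j z * \<bar>t z - s z\<bar> \<partial>(M \<Otimes>\<^sub>M M)) \<le> (\<integral>z. c i j z * \<bar>h z - s z\<bar> \<partial>(M \<Otimes>\<^sub>M M))" .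
    qed
    also have "\<dots> = (\<integral>z. \<bar>h z - s z\<bar> \<partial>(M \<Otimes>\<^sub>M M))"
      by (rule decI[OF hs, symmetric])
    finally have ts: "(\<integral>z. \<bar>t z - s z\<bar> \<partial>(M \<Otimes>\<^sub>M M)) \<le> (\<integral>z. \<bar>h z - s z\<bar> \<partial>(M \<Otimes>\<^sub>M M))" .
    have "(\<integral>z. \<bar>h z - t z\<bar> \<partial>(M \<Otimes>\<^sub>M M)) \<le> (\<integral>z. \<bar>h z - s z\<bar> + \<bar>t z - s z\<bar> \<partial>(M \<Otimes>\<^sub>M M))"
      by (rule integral_mono) (use h s t in auto)
    also have "\<dots> = (\<integral>z. \<bar>h z - s z\<bar> \<partial>(M \<Otimes>\<^sub>M M)) + (\<integral>z. \<bar>t z - s z\<bar> \<partial>(M \<Otimes>\<^sub>M M))"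
      by (rule Bochner_Integration.integral_add) (use h s t in auto)
    also have "\<dots> \<le> e" using ts S unfolding s_def by linarith
    finally show ?thesis by (simp add: h_def t_def)
  qed
  ultimately show ?thesis
    using that[of p A] p unfolding R_def by blast
qed

text \<open>Apart from \<open>k1\<close> the integrand is bounded by \<open>N\<close>, so replacing
  \<open>k1\<close> by a step kernel costs at most \<open>N\<close> times the \<open>L^1\<close>
  error. Positivity of \<open>k1\<close> is assumed for its form, because that is what averaging
  over cells uses; of \<open>k2\<close> the form bound matters.\<close>

lemma Schur_product_form_bound:
  assumes k1: "(\<lambda>(x, y). k1 x y) \<in> borel_measurable (M \<Otimes>\<^sub>M M)"
    and C: "\<And>x y. x \<in> space M \<Longrightarrow> y \<in> space M \<Longrightarrow> \<bar>k1 x y\<bar> \<le> C"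
    and sym: "\<And>x y. x \<in> space M \<Longrightarrow> y \<in> space M \<Longrightarrow> k1 x y = k1 y x"
    and psd: "\<And>h. h \<in> L2 M \<Longrightarrow> 0 \<le> L2_inner M h (integral_op M k1 h)"
    and k2: "(\<lambda>(x, y). k2 x y) \<in> borel_measurable (M \<Otimes>\<^sub>M M)"
    and op: "\<And>u w. u \<in> L2 M \<Longrightarrow> w \<in> L2 M \<Longrightarrow>
      \<bar>L2_inner M u (integral_op M k2 w)\<bar> \<le> \<kappa> * (sqrt (L2_inner M u u) * sqrt (L2_inner M w w))"
    and \<kappa>: "0 \<le> \<kappa>"
    and g: "g \<in> L2 M" and f: "f \<in> L2 M"
    and bnd: "\<And>x y. x \<in> space M \<Longrightarrow> y \<in> space M \<Longrightarrow> \<bar>g x * k2 x y * f y\<bar> \<le> N"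
  shows "\<bar>L2_inner M g (integral_op M (\<lambda>x y. k1 x y * k2 x y) f)\<bar>
    \<le> \<kappa> * C * (sqrt (L2_inner M g g) * sqrt (L2_inner M f f))"
proof (rule field_le_epsilon)
  fix e :: real assume e: "0 < e"
  obtain x0 where x0: "x0 \<in> space M" using not_empty by blast
  have N: "0 \<le> N" using bnd[OF x0 x0] by linarith
  define \<phi> where "\<phi> = (\<lambda>z. g (fst z) * k2 (fst z) (snd z) * f (snd z))"
  define h where "h = (\<lambda>z. k1 (fst z) (snd z))"
  have \<phi>m [measurable]: "\<phi> \<in> borel_measurable (M \<Otimes>\<^sub>M M)"
    unfolding \<phi>_def by (rule borel_measurable_form[OF k2 L2_measurable[OF g] L2_measurable[OF f]])
  have hm [measurable]: "h \<in> borel_measurable (M \<Otimes>\<^sub>M M)"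
    using k1 by (simp add: h_def case_prod_beta')
  have \<phi>N: "\<bar>\<phi> z\<bar> \<le> N" if "z \<in> space (M \<Otimes>\<^sub>M M)" for z
    using bnd that by (auto simp: \<phi>_def space_pair_measure)
  have int: "integrable (M \<Otimes>\<^sub>M M) (\<lambda>z. \<psi> z * \<phi> z)" if "integrable (M \<Otimes>\<^sub>M M) \<psi>" for \<psi> :: "_ \<Rightarrow> real"
  proof (rule Bochner_Integration.integrable_bound)
    show "integrable (M \<Otimes>\<^sub>M M) (\<lambda>z. N * \<psi> z)" using that by simp
    show "(\<lambda>z. \<psi> z * \<phi> z) \<in> borel_measurable (M \<Otimes>\<^sub>M M)" using that by measurable
    show "AE z in M \<Otimes>\<^sub>M M. norm (\<psi> z * \<phi> z) \<le> norm (N * \<psi> z)"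
    proof (rule AE_I2)
      fix z assume "z \<in> space (M \<Otimes>\<^sub>M M)"
      from mult_left_mono[OF \<phi>N[OF this], of "\<bar>\<psi> z\<bar>"] N
      show "norm (\<psi> z * \<phi> z) \<le> norm (N * \<psi> z)" by (simp add: abs_mult mult.commute)
    qed
  qed
  have h: "integrable (M \<Otimes>\<^sub>M M) h"
    by (intro P.integrable_const_bound[where B=C] AE_I2 hm) (auto simp: h_def space_pair_measure C)
  \<comment> \<open>The \<open>+ 1\<close> keeps the tolerance positive when \<open>N = 0\<close>,
    since \<open>e / 0 = 0\<close>.\<close>
  have eN: "0 < e / (N + 1)" using e N by simp
  obtain p :: "'a \<Rightarrow> nat" and A where p: "simple_function M p" "psd_kernel (p ` space M) A"
      "\<forall>i\<in>p ` space M. A i i \<le> C"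
      and A: "(\<integral>z. \<bar>k1 (fst z) (snd z) - A (p (fst z)) (p (snd z))\<bar> \<partial>(M \<Otimes>\<^sub>M M)) \<le> e / (N + 1)"
    by (rule psd_step_approximation[OF k1 C sym psd eN])
  define t where "t = (\<lambda>z. A (p (fst z)) (p (snd z)))"
  have t: "integrable (M \<Otimes>\<^sub>M M) t"
    unfolding t_def by (rule integrable_step[OF p(1)])
  have "(\<integral>z. (h z - t z) * \<phi> z \<partial>(M \<Otimes>\<^sub>M M)) \<le> (\<integral>z. N * \<bar>h z - t z\<bar> \<partial>(M \<Otimes>\<^sub>M M))" (is "?D \<le> _")
    and "- (\<integral>z. (h z - t z) * \<phi> z \<partial>(M \<Otimes>\<^sub>M M)) \<le> (\<integral>z. N * \<bar>h z - t z\<bar> \<partial>(M \<Otimes>\<^sub>M M))"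
  proof -
    have le: "\<bar>(h z - t z) * \<phi> z\<bar> \<le> N * \<bar>h z - t z\<bar>" if "z \<in> space (M \<Otimes>\<^sub>M M)" for z
      using mult_left_mono[OF \<phi>N[OF that], of "\<bar>h z - t z\<bar>"] by (simp add: abs_mult mult.commute)
    have i1: "integrable (M \<Otimes>\<^sub>M M) (\<lambda>z. (h z - t z) * \<phi> z)"
      by (rule int) (use h t in simp)
    have i2: "integrable (M \<Otimes>\<^sub>M M) (\<lambda>z. N * \<bar>h z - t z\<bar>)"
      using h t by simp
    have "\<bar>?D\<bar> \<le> (\<integral>z. \<bar>(h z - t z) * \<phi> z\<bar> \<partial>(M \<Otimes>\<^sub>M M))"
      by (rule integral_abs_bound)
    also have "\<dots> \<le> (\<integral>z. N * \<bar>h z - t z\<bar> \<partial>(M \<Otimes>\<^sub>M M))"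
      by (rule integral_mono[OF integrable_abs[OF i1] i2 le])
    finally show "?D \<le> (\<integral>z. N * \<bar>h z - t z\<bar> \<partial>(M \<Otimes>\<^sub>M M))"
      "- ?D \<le> (\<integral>z. N * \<bar>h z - t z\<bar> \<partial>(M \<Otimes>\<^sub>M M))" by linarith+
  qed
  moreover have "(\<integral>z. N * \<bar>h z - t z\<bar> \<partial>(M \<Otimes>\<^sub>M M)) \<le> N * (e / (N + 1))"
    using mult_left_mono[OF A N] by (simp add: t_def h_def)
  moreover have "N * (e / (N + 1)) \<le> e"
    using e N by (simp add: field_simps)
  ultimately have D: "\<bar>?D\<bar> \<le> e" by linarith
  have "L2_inner M g (integral_op M (\<lambda>x y. k1 x y * k2 x y) f) = (\<integral>z. h z * \<phi> z \<partial>(M \<Otimes>\<^sub>M M))"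
  proof -
    have eq: "g (fst z) * (k1 (fst z) (snd z) * k2 (fst z) (snd z)) * f (snd z) = h z * \<phi> z" for z
      by (simp add: h_def \<phi>_def)
    show ?thesis
      using integral_op_form_eq[of g "\<lambda>x y. k1 x y * k2 x y" f] int[OF h] unfolding eq by simp
  qed
  also have "\<dots> = (\<integral>z. t z * \<phi> z \<partial>(M \<Otimes>\<^sub>M M)) + ?D"
    using int[OF h] int[OF t] by (simp add: left_diff_distrib)
  finally have "\<bar>L2_inner M g (integral_op M (\<lambda>x y. k1 x y * k2 x y) f)\<bar> \<le>
      \<bar>\<integral>z. t z * \<phi> z \<partial>(M \<Otimes>\<^sub>M M)\<bar> + e"
    using D by linarith
  also have "\<bar>\<integral>z. t z * \<phi> z \<partial>(M \<Otimes>\<^sub>M M)\<bar> \<le> \<kappa> * C * (sqrt (L2_inner M g g) * sqrt (L2_inner M f f))"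
    unfolding t_def \<phi>_def by (rule finite_rank_form_bound[OF p(1,2) bspec[OF p(3)] f g k2 bnd op \<kappa>])
  finally show "\<bar>L2_inner M g (integral_op M (\<lambda>x y. k1 x y * k2 x y) f)\<bar> \<le>
      \<kappa> * C * (sqrt (L2_inner M g g) * sqrt (L2_inner M f f)) + e" by simp
qed

section \<open>Truncation and passage to the limit\<close>

lemma borel_measurable_diag:
  assumes "(\<lambda>(x, y). k x y :: real) \<in> borel_measurable (M \<Otimes>\<^sub>M M)"
  shows "(\<lambda>x. k x x) \<in> borel_measurable M"
  using measurable_compose[OF measurable_Pair[OF measurable_ident measurable_ident] assms]
  by simp

text \<open>A duality argument that does not presuppose \<open>K f\<close> in \<open>L2 M\<close>: a
  truncation of \<open>K (fn n)\<close> is tested against \<open>K (fn n)\<close>, and dividing the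
  form bound by the norm of the test function bounds that norm uniformly in \<open>n\<close>.
  Fatou's lemma carries the bound over to \<open>K f\<close>.\<close>

lemma Schur_product_L2_bound:
  assumes k1: "(\<lambda>(x, y). k1 x y) \<in> borel_measurable (M \<Otimes>\<^sub>M M)"
    and C: "\<And>x y. x \<in> space M \<Longrightarrow> y \<in> space M \<Longrightarrow> \<bar>k1 x y\<bar> \<le> C"
    and sym: "\<And>x y. x \<in> space M \<Longrightarrow> y \<in> space M \<Longrightarrow> k1 x y = k1 y x"
    and psd: "\<And>h. h \<in> L2 M \<Longrightarrow> 0 \<le> L2_inner M h (integral_op M k1 h)"
    and k2: "(\<lambda>(x, y). k2 x y) \<in> borel_measurable (M \<Otimes>\<^sub>M M)"
    and psd2: "psd_kernel (space M) k2"
    and op: "\<And>u w. u \<in> L2 M \<Longrightarrow> w \<in> L2 M \<Longrightarrow>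
      \<bar>L2_inner M u (integral_op M k2 w)\<bar> \<le> \<kappa> * (sqrt (L2_inner M u u) * sqrt (L2_inner M w w))"
    and \<kappa>: "0 \<le> \<kappa>"
    and f: "f \<in> L2 M" and int: "AE x in M. integrable M (\<lambda>y. k2 x y * f y)"
  shows "AE x in M. integrable M (\<lambda>y. k1 x y * k2 x y * f y)"
    and "integral_op M (\<lambda>x y. k1 x y * k2 x y) f \<in> L2 M"
    and "L2_inner M (integral_op M (\<lambda>x y. k1 x y * k2 x y) f)
      (integral_op M (\<lambda>x y. k1 x y * k2 x y) f) \<le> (\<kappa> * C)\<^sup>2 * L2_inner M f f"
proof -
  let ?n = "\<lambda>h. sqrt (L2_inner M h h)"
  let ?k = "\<lambda>x y. k1 x y * k2 x y"
  define K where "K = integral_op M ?k"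
  obtain x0 where x0: "x0 \<in> space M" using not_empty by blast
  have C0: "0 \<le> C" using C[OF x0 x0] by linarith
  have k: "(\<lambda>(x, y). ?k x y) \<in> borel_measurable (M \<Otimes>\<^sub>M M)"
    using borel_measurable_times[OF k1 k2] by (simp add: case_prod_beta')
  have Km: "K h \<in> borel_measurable M" if "h \<in> borel_measurable M" for h
    unfolding K_def by (rule borel_measurable_integral_op[OF k that])
  have sect: "(\<lambda>y. ?k x y) \<in> borel_measurable M" if "x \<in> space M" for x
    using measurable_compose[OF measurable_Pair1'[OF that] k] by simp
  note [measurable] = borel_measurable_diag[OF k2]
  note fm [measurable] = L2_measurable[OF f]
  \<comment> \<open>Cutting at \<open>k2 x x \<le> real n\<close> bounds \<open>k2\<close> by
    Cauchy--Schwarz; cutting at \<open>\<bar>h x\<bar> \<le> real n\<close> makes the function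
    bounded and thus square-integrable.\<close>
  define tr where "tr = (\<lambda>(n::nat) h x. h x * (if k2 x x \<le> real n \<and> \<bar>h x\<bar> \<le> real n then 1 else 0) :: real)"
  have trm: "tr n h \<in> borel_measurable M" if [measurable]: "h \<in> borel_measurable M" for n h
    unfolding tr_def by measurable
  have tr_le: "\<bar>tr n h x\<bar> \<le> \<bar>h x\<bar>" "\<bar>tr n h x\<bar> \<le> real n" for n h x
    by (auto simp: tr_def)
  define fn where "fn = (\<lambda>n. tr n f)"
  define g where "g = (\<lambda>n. tr n (K (fn n)))"
  have one: "(\<lambda>_. 1) \<in> L2 M" by (simp add: L2_def)
  have trL2: "tr n h \<in> L2 M" if "h \<in> borel_measurable M" for n h
    using L2_mult_bounded[OF one trm[OF that] tr_le(2)] by simp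
  have fnm: "fn n \<in> borel_measurable M" and fnL2: "fn n \<in> L2 M" for n
    unfolding fn_def by (rule trm trL2, rule fm)+
  have gm [measurable]: "g n \<in> borel_measurable M" and gL2: "g n \<in> L2 M" for n
    unfolding g_def by (rule trm trL2, rule Km, rule fnm)+
  have g_bound: "L2_inner M (g n) (g n) \<le> (\<kappa> * C)\<^sup>2 * L2_inner M f f" for n
  proof -
    have bnd: "\<bar>g n x * k2 x y * fn n y\<bar> \<le> real n * real n * real n" if "x \<in> space M" "y \<in> space M" for x y
    proof (cases "k2 x x \<le> real n \<and> k2 y y \<le> real n")
      case True
      then have "\<bar>k2 x y\<bar> \<le> real n" using psd_kernel_abs_le[OF psd2 that] by blast
      then show ?thesis
        unfolding abs_mult g_def fn_def by (intro mult_mono tr_le) auto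
    next
      case False
      then have zero: "g n x * k2 x y * fn n y = 0" by (auto simp: g_def fn_def tr_def)
      show ?thesis unfolding zero by simp
    qed
    \<comment> \<open>Wherever \<open>g n\<close> does not vanish it coincides with
      \<open>K (fn n)\<close>.\<close>
    have "L2_inner M (g n) (g n) = L2_inner M (g n) (K (fn n))"
      unfolding L2_inner_def
      by (intro Bochner_Integration.integral_cong refl) (simp add: g_def tr_def)
    also have "\<dots> \<le> \<kappa> * C * (?n (g n) * ?n (fn n))"
      using Schur_product_form_bound[OF k1 C sym psd k2 op \<kappa> gL2 fnL2 bnd] unfolding K_def
      by (rule order_trans[OF abs_ge_self])
    also have "\<dots> \<le> \<kappa> * C * (?n (g n) * ?n f)"
    proof (intro mult_left_mono real_sqrt_le_mono)
      show "L2_inner M (fn n) (fn n) \<le> L2_inner M f f"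
        unfolding L2_inner_def
      proof (rule integral_mono[OF L2_integrable_mult[OF fnL2 fnL2] L2_integrable_mult[OF f f]])
        fix x show "fn n x * fn n x \<le> f x * f x"
          by (simp add: fn_def tr_def)
      qed
    qed (use \<kappa> C0 in \<open>simp_all add: L2_inner_self_nonneg\<close>)
    finally have "?n (g n) * ?n (g n) \<le> ?n (g n) * (\<kappa> * C * ?n f)"
      by (simp add: L2_inner_self_nonneg mult_ac)
    then have "?n (g n) \<le> \<kappa> * C * ?n f"
    proof (cases "?n (g n) = 0")
      case True
      then show ?thesis using \<kappa> C0 by (simp add: L2_inner_self_nonneg)
    next
      case False
      then have "0 < ?n (g n)"
        using real_sqrt_ge_zero[OF L2_inner_self_nonneg[of M "g n"]] by linarith
      then show ?thesis
        using \<open>?n (g n) * ?n (g n) \<le> _\<close> mult_le_cancel_left_pos by blast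
    qed
    from power_mono[OF this, of 2] show ?thesis
      by (simp add: L2_inner_self_nonneg power_mult_distrib)
  qed
  have int_k: "integrable M (\<lambda>y. ?k x y * f y)"
    if x: "x \<in> space M" and ix: "integrable M (\<lambda>y. k2 x y * f y)" for x
  proof (rule Bochner_Integration.integrable_bound)
    show "integrable M (\<lambda>y. C * (k2 x y * f y))" using ix by simp
    show "(\<lambda>y. ?k x y * f y) \<in> borel_measurable M"
      using sect[OF x] fm by (rule borel_measurable_times)
    show "AE y in M. norm (?k x y * f y) \<le> norm (C * (k2 x y * f y))"
    proof (rule AE_I2)
      fix y assume "y \<in> space M"
      from mult_right_mono[OF C[OF x this], of "\<bar>k2 x y * f y\<bar>"] C0
      show "norm (?k x y * f y) \<le> norm (C * (k2 x y * f y))"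
        by (simp add: abs_mult mult.assoc)
    qed
  qed
  show ae_int: "AE x in M. integrable M (\<lambda>y. ?k x y * f y)"
    using int AE_space by eventually_elim (rule int_k)
  have lim: "AE x in M. (\<lambda>n. g n x) \<longlonglongrightarrow> K f x"
    using ae_int AE_space
  proof eventually_elim
    case (elim x)
    \<comment> \<open>At a fixed point both cut-offs are inactive from some \<open>n\<close>
      on.\<close>
    have ev: "\<forall>\<^sub>F n in sequentially. k2 y y \<le> real n \<and> c \<le> real n" for y c
      using eventually_ge_at_top[of "nat \<lceil>max (k2 y y) c\<rceil>"]
      by eventually_elim linarith
    have Kfn: "(\<lambda>n. K (fn n) x) \<longlonglongrightarrow> K f x"
      unfolding K_def integral_op_def
    proof (rule integral_dominated_convergence[where w="\<lambda>y. \<bar>?k x y * f y\<bar>"])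
      show "(\<lambda>y. ?k x y * f y) \<in> borel_measurable M" "(\<lambda>y. ?k x y * fn n y) \<in> borel_measurable M" for n
        using sect[OF elim(2)] fm fnm by (auto intro!: borel_measurable_times)
      show "integrable M (\<lambda>y. \<bar>?k x y * f y\<bar>)"
        using elim(1) by simp
      show "AE y in M. (\<lambda>n. ?k x y * fn n y) \<longlonglongrightarrow> ?k x y * f y"
      proof (rule AE_I2)
        fix y
        have "\<forall>\<^sub>F n in sequentially. fn n y = f y"
          using ev[of y "\<bar>f y\<bar>"] by eventually_elim (simp add: fn_def tr_def)
        then have "(\<lambda>n. fn n y) \<longlonglongrightarrow> f y" by (rule tendsto_eventually)
        then show "(\<lambda>n. ?k x y * fn n y) \<longlonglongrightarrow> ?k x y * f y" by (rule tendsto_mult_left)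
      qed
      show "AE y in M. norm (?k x y * fn n y) \<le> \<bar>?k x y * f y\<bar>" for n
        by (rule AE_I2) (auto simp: abs_mult fn_def intro!: mult_left_mono tr_le)
    qed
    \<comment> \<open>The function truncated in \<open>g n\<close> itself varies with
      \<open>n\<close>. Convergence bounds its values at \<open>x\<close> by
      \<open>\<bar>K f x\<bar> + 1\<close> eventually, so this truncation becomes inactive as
      well.\<close>
    have "\<forall>\<^sub>F n in sequentially. \<bar>K (fn n) x\<bar> < \<bar>K f x\<bar> + 1"
      by (rule order_tendstoD(2)[OF tendsto_rabs[OF Kfn]]) simp
    with ev[of x "\<bar>K f x\<bar> + 1"] have "\<forall>\<^sub>F n in sequentially. K (fn n) x = g n x"
      by eventually_elim (simp add: g_def tr_def)
    with Kfn show ?case by (rule Lim_transform_eventually)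
  qed
  have Kfm [measurable]: "K f \<in> borel_measurable M" by (rule Km[OF fm])
  have nn: "(\<integral>\<^sup>+x. ennreal ((K f x)\<^sup>2) \<partial>M) \<le> ennreal ((\<kappa> * C)\<^sup>2 * L2_inner M f f)"
  proof -
    have "(\<integral>\<^sup>+x. ennreal ((K f x)\<^sup>2) \<partial>M) = (\<integral>\<^sup>+x. liminf (\<lambda>n. ennreal ((g n x)\<^sup>2)) \<partial>M)"
    proof (rule nn_integral_cong_AE)
      show "AE x in M. ennreal ((K f x)\<^sup>2) = liminf (\<lambda>n. ennreal ((g n x)\<^sup>2))"
        using lim
      proof eventually_elim
        case (elim x)
        from tendsto_ennrealI[OF tendsto_power[OF elim, of 2]] show ?case
          by (rule lim_imp_Liminf[OF sequentially_bot, symmetric])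
      qed
    qed
    also have "\<dots> \<le> liminf (\<lambda>n. \<integral>\<^sup>+x. ennreal ((g n x)\<^sup>2) \<partial>M)"
      by (rule nn_integral_liminf) measurable
    also have "\<dots> \<le> liminf (\<lambda>n. ennreal ((\<kappa> * C)\<^sup>2 * L2_inner M f f))"
    proof (intro Liminf_mono always_eventually allI)
      fix n
      have "(\<integral>\<^sup>+x. ennreal ((g n x)\<^sup>2) \<partial>M) = ennreal (\<integral>x. (g n x)\<^sup>2 \<partial>M)"
        by (rule nn_integral_eq_integral[OF L2_integrable_square[OF gL2]]) simp
      also have "\<dots> \<le> ennreal ((\<kappa> * C)\<^sup>2 * L2_inner M f f)"
        using g_bound[of n] by (intro ennreal_leI) (simp add: L2_inner_def power2_eq_square)
      finally show "(\<integral>\<^sup>+x. ennreal ((g n x)\<^sup>2) \<partial>M) \<le> ennreal ((\<kappa> * C)\<^sup>2 * L2_inner M f f)" .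
    qed
    also have "\<dots> = ennreal ((\<kappa> * C)\<^sup>2 * L2_inner M f f)"
      by (simp add: Liminf_const)
    finally show ?thesis .
  qed
  have Ki: "integrable M (\<lambda>x. (K f x)\<^sup>2)"
    by (rule integrableI_bounded) (use nn in \<open>auto intro: le_less_trans\<close>)
  then show "integral_op M ?k f \<in> L2 M"
    using Kfm by (simp add: L2_def K_def)
  have "ennreal (\<integral>x. (K f x)\<^sup>2 \<partial>M) \<le> ennreal ((\<kappa> * C)\<^sup>2 * L2_inner M f f)"
    using nn nn_integral_eq_integral[OF Ki] by simp
  then have "(\<integral>x. (K f x)\<^sup>2 \<partial>M) \<le> (\<kappa> * C)\<^sup>2 * L2_inner M f f"
    by (simp add: ennreal_le_iff L2_inner_self_nonneg)
  then show "L2_inner M (integral_op M ?k f) (integral_op M ?k f) \<le> (\<kappa> * C)\<^sup>2 * L2_inner M f f"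
    by (simp add: L2_inner_def K_def power2_eq_square)
qed

section \<open>Vanishing factors\<close>

text \<open>The Schur product of \<open>k\<close> with its own truncation has, at the test function
  \<open>a n\<close>, the integral of the squared truncated kernel as its form. The form bound with
  \<kappa> = 0 makes this integral vanish.\<close>

lemma psd_kernel_null_form_AE_zero:
  assumes k: "(\<lambda>(x, y). k x y) \<in> borel_measurable (M \<Otimes>\<^sub>M M)"
    and psd: "psd_kernel (space M) k"
    and null: "\<And>u w. u \<in> L2 M \<Longrightarrow> w \<in> L2 M \<Longrightarrow> L2_inner M u (integral_op M k w) = 0"
  shows "AE z in M \<Otimes>\<^sub>M M. k (fst z) (snd z) = 0"
proof -
  note km [measurable] = k[unfolded case_prod_beta']
  note [measurable] = borel_measurable_diag[OF k]
  have one: "(\<lambda>_. 1) \<in> L2 M" by (simp add: L2_def)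
  define a where "a = (\<lambda>(n::nat) x. if k x x \<le> real n then 1 else 0 :: real)"
  have am [measurable]: "a n \<in> borel_measurable M" for n
    unfolding a_def by measurable
  have a1: "\<bar>a n x\<bar> \<le> 1" and aa: "a n x * a n x = a n x" for n x by (auto simp: a_def)
  have aL2: "(\<lambda>x. h x * a n x) \<in> L2 M" if "h \<in> L2 M" for h n
    by (rule L2_mult_bounded[OF that am a1])
  have aL2': "a n \<in> L2 M" for n
    using aL2[OF one] by simp
  have bnd: "\<bar>a n x * k x y * a n y\<bar> \<le> real n" if "x \<in> space M" "y \<in> space M" for x y n
    using psd_kernel_abs_le[OF psd that, of "real n"] by (auto simp: a_def)
  have "AE z in M \<Otimes>\<^sub>M M. (a n (fst z) * k (fst z) (snd z) * a n (snd z))\<^sup>2 = 0" for n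
  proof -
    let ?k = "\<lambda>x y. a n x * k x y * a n y"
    let ?q = "\<lambda>z. (?k (fst z) (snd z))\<^sup>2"
    have qi: "integrable (M \<Otimes>\<^sub>M M) ?q"
    proof (rule P.integrable_const_bound[where B="(real n)\<^sup>2"])
      show "AE z in M \<Otimes>\<^sub>M M. norm (?q z) \<le> (real n)\<^sup>2"
      proof (rule AE_I2)
        fix z assume "z \<in> space (M \<Otimes>\<^sub>M M)"
        then have "\<bar>?k (fst z) (snd z)\<bar> \<le> real n" by (intro bnd) (auto simp: space_pair_measure)
        from power_mono[OF this, of 2] show "norm (?q z) \<le> (real n)\<^sup>2" by simp
      qed
    qed measurable
    have "\<bar>L2_inner M (a n) (integral_op M (\<lambda>x y. ?k x y * k x y) (a n))\<bar>
        \<le> 0 * real n * (sqrt (L2_inner M (a n) (a n)) * sqrt (L2_inner M (a n) (a n)))"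
    \<comment> \<open>The truncation of \<open>k\<close> itself is admissible as first factor: its form vanishes, hence is nonnegative.\<close>
    proof (rule Schur_product_form_bound[OF _ bnd _ _ k _ order_refl aL2' aL2' bnd])
      show "(\<lambda>(x, y). ?k x y) \<in> borel_measurable (M \<Otimes>\<^sub>M M)"
        unfolding case_prod_beta' by measurable
      show "?k x y = ?k y x" if "x \<in> space M" "y \<in> space M" for x y
        using psd_kernel_sym[OF psd that] by simp
      show "0 \<le> L2_inner M h (integral_op M ?k h)" if "h \<in> L2 M" for h
      proof -
        have "integral_op M ?k h x = a n x * integral_op M k (\<lambda>x. h x * a n x) x" for x
          by (simp add: integral_op_def mult_ac flip: integral_mult_right_zero)
        then have "L2_inner M h (integral_op M ?k h) =
            L2_inner M (\<lambda>x. h x * a n x) (integral_op M k (\<lambda>x. h x * a n x))"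
          by (simp add: L2_inner_def mult_ac)
        also have "\<dots> = 0" by (intro null aL2 that)
        finally show ?thesis by simp
      qed
    next
      show "\<bar>L2_inner M u (integral_op M k w)\<bar> \<le> 0 * (sqrt (L2_inner M u u) * sqrt (L2_inner M w w))"
        if "u \<in> L2 M" "w \<in> L2 M" for u w
        using null[OF that] by simp
    qed
    then have "0 = L2_inner M (a n) (integral_op M (\<lambda>x y. ?k x y * k x y) (a n))" by simp
    also have "\<dots> = (\<integral>z. ?q z \<partial>(M \<Otimes>\<^sub>M M))"
    proof -
      have eq: "a n (fst z) * (?k (fst z) (snd z) * k (fst z) (snd z)) * a n (snd z) = ?q z" for z
        by (simp add: power2_eq_square mult_ac)
      show ?thesis
        using integral_op_form_eq[of "a n" "\<lambda>x y. ?k x y * k x y" "a n"] qi unfolding eq by simp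
    qed
    finally show ?thesis
      using integral_nonneg_eq_0_iff_AE[OF qi] by simp
  qed
  then have "AE z in M \<Otimes>\<^sub>M M. \<forall>n. (a n (fst z) * k (fst z) (snd z) * a n (snd z))\<^sup>2 = 0"
    by (simp add: AE_all_countable)
  then show ?thesis
  proof eventually_elim
    case (elim z)
    \<comment> \<open>Both coordinates of \<open>z\<close> pass the cut-off for large
      \<open>n\<close>, so the countably many null sets exhaust the set where \<open>k\<close> is
      nonzero.\<close>
    obtain n :: nat where "max (k (fst z) (fst z)) (k (snd z) (snd z)) \<le> real n"
      using real_arch_simple by blast
    with elim[rule_format, of n] show ?case by (simp add: a_def)
  qed
qed

text \<open>By Fubini's theorem almost every section of \<open>k\<close> vanishes almost everywhere.
  This settles the cases in which one factor of the bound is 0 and the other may be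
  infinite.\<close>

lemma AE_zero_integral_operator:
  assumes k: "(\<lambda>(x, y). k x y) \<in> borel_measurable (M \<Otimes>\<^sub>M M)"
    and zero: "AE z in M \<Otimes>\<^sub>M M. k (fst z) (snd z) = 0"
  shows "L2_integral_operator M k" and "L2_opnorm M (integral_op M k) = 0"
proof -
  have ae: "AE x in M. AE y in M. k x y = 0"
    using P.AE_pair[OF zero] by simp
  have sect: "k x \<in> borel_measurable M" if "x \<in> space M" for x
    using measurable_compose[OF measurable_Pair1'[OF that] k] by simp
  have int: "AE x in M. integrable M (\<lambda>y. k x y * f y)" if f: "f \<in> L2 M" for f
    using ae AE_space
  proof eventually_elim
    case (elim x)
    have "(\<lambda>y. k x y * f y) \<in> borel_measurable M"
      using sect[OF elim(2)] L2_measurable[OF f] by (rule borel_measurable_times)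
    moreover have "AE y in M. k x y * f y = 0"
      using elim(1) by eventually_elim simp
    ultimately show ?case
      by (simp add: integrable_cong_AE[where g="\<lambda>_. 0"])
  qed
  have K0: "AE x in M. integral_op M k f x = 0" for f
    using ae
  proof eventually_elim
    case (elim x)
    then have "AE y in M. k x y * f y = 0" by eventually_elim simp
    then show ?case unfolding integral_op_def by (rule integral_eq_zero_AE)
  qed
  have L2: "integral_op M k f \<in> L2 M" if f: "f \<in> L2 M" for f
  proof -
    have m [measurable]: "integral_op M k f \<in> borel_measurable M"
      by (rule borel_measurable_integral_op[OF k L2_measurable[OF f]])
    have "AE x in M. (integral_op M k f x)\<^sup>2 = 0"
      using K0[of f] by eventually_elim simp
    then have "integrable M (\<lambda>x. (integral_op M k f x)\<^sup>2)"
      by (simp add: integrable_cong_AE[where g="\<lambda>_. 0"])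
    with m show ?thesis by (simp add: L2_def)
  qed
  show "L2_integral_operator M k"
    by (rule L2_integral_operatorI[OF k int L2])
  have "L2_opnorm M (integral_op M k) \<le> ennreal 0"
  proof (rule L2_opnorm_leI[OF L2])
    fix f
    have "AE x in M. integral_op M k f x * integral_op M k f x = 0"
      using K0[of f] by eventually_elim simp
    then show "L2_inner M (integral_op M k f) (integral_op M k f) \<le> 0\<^sup>2 * L2_inner M f f"
      unfolding L2_inner_def by (simp add: integral_eq_zero_AE)
  qed simp_all
  then show "L2_opnorm M (integral_op M k) = 0" by simp
qed

section \<open>The norm bound on a probability space\<close>

text \<open>For infinite \<open>B\<close> the inequality is trivial. Since
  \<open>0 * \<infinity> = 0\<close> in \<open>ennreal\<close>, a finite \<open>B\<close> leaves
  three cases: either factor is 0, or both are finite.\<close>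

theorem Schur_product_integral_operator:
  assumes k1: "psd_kernel (space M) k1" and k2: "psd_kernel (space M) k2"
    and K1: "L2_integral_operator M k1" and K2: "L2_integral_operator M k2"
    and psd: "\<And>h. h \<in> L2 M \<Longrightarrow> 0 \<le> L2_inner M h (integral_op M k1 h)"
  defines "B \<equiv> L2_opnorm M (integral_op M k2) * (SUP x\<in>space M. ennreal \<bar>k1 x x\<bar>)"
  shows "B < \<infinity> \<Longrightarrow> L2_integral_operator M (\<lambda>x y. k1 x y * k2 x y)"
    and "L2_opnorm M (integral_op M (\<lambda>x y. k1 x y * k2 x y)) \<le> B"
proof -
  let ?k = "\<lambda>x y. k1 x y * k2 x y"
  have m1: "(\<lambda>(x, y). k1 x y) \<in> borel_measurable (M \<Otimes>\<^sub>M M)"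
    and m2: "(\<lambda>(x, y). k2 x y) \<in> borel_measurable (M \<Otimes>\<^sub>M M)"
    and lin2: "L2_linear_operator M (integral_op M k2)"
    and int2: "\<And>f. f \<in> L2 M \<Longrightarrow> AE x in M. integrable M (\<lambda>y. k2 x y * f y)"
    using K1 K2 by (simp_all add: L2_integral_operator_def)
  have m: "(\<lambda>(x, y). ?k x y) \<in> borel_measurable (M \<Otimes>\<^sub>M M)"
    using borel_measurable_times[OF m1 m2] by (simp add: case_prod_beta')
  have "(B < \<infinity> \<longrightarrow> L2_integral_operator M ?k) \<and> L2_opnorm M (integral_op M ?k) \<le> B"
  proof (cases "B < \<infinity>")
    case False
    then have "B = top" by (simp add: not_less top_unique)
    then show ?thesis by simp
  next
    case fin: True
    define S where "S = (SUP x\<in>space M. ennreal \<bar>k1 x x\<bar>)"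
    define \<kappa> where "\<kappa> = enn2real (L2_opnorm M (integral_op M k2))"
    define C where "C = enn2real S"
    have diag: "ennreal \<bar>k1 x x\<bar> \<le> S" if "x \<in> space M" for x
      unfolding S_def by (rule SUP_upper[OF that])
    consider "L2_opnorm M (integral_op M k2) = 0" | "S = 0"
      | "L2_opnorm M (integral_op M k2) \<noteq> top" "S \<noteq> top"
      using fin unfolding B_def S_def[symmetric] by (auto simp: ennreal_mult_less_top less_top)
    then show ?thesis
    proof cases
      case 1
      \<comment> \<open>The diagonal of \<open>k1\<close> may be unbounded here, so the bound for
        bounded \<open>k1\<close> does not apply; instead \<open>k2\<close> is shown to vanish
        almost everywhere.\<close>
      have null: "L2_inner M u (integral_op M k2 w) = 0" if "u \<in> L2 M" "w \<in> L2 M" for u w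
        using L2_opnorm_form_bound[OF lin2 _ order_refl that] 1 by simp
      have "AE z in M \<Otimes>\<^sub>M M. k2 (fst z) (snd z) = 0"
        by (rule psd_kernel_null_form_AE_zero[OF m2 k2 null])
      then have "AE z in M \<Otimes>\<^sub>M M. ?k (fst z) (snd z) = 0"
        by eventually_elim simp
      from AE_zero_integral_operator[OF m this] show ?thesis by simp
    next
      case 2
      \<comment> \<open>The operator norm of \<open>k2\<close> may be infinite here, but a zero
        diagonal forces \<open>k1\<close> to vanish identically.\<close>
      have "\<bar>k1 x y\<bar> \<le> 0" if "x \<in> space M" "y \<in> space M" for x y
        using diag[OF that(1)] diag[OF that(2)] 2
        by (intro psd_kernel_abs_le[OF k1 that]) simp_all
      then have "AE z in M \<Otimes>\<^sub>M M. ?k (fst z) (snd z) = 0"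
        by (intro AE_I2) (auto simp: space_pair_measure)
      from AE_zero_integral_operator[OF m this] show ?thesis by simp
    next
      case 3
      have \<kappa>: "L2_opnorm M (integral_op M k2) = ennreal \<kappa>" "0 \<le> \<kappa>"
        and C: "S = ennreal C" "0 \<le> C"
        using 3 by (simp_all add: \<kappa>_def C_def less_top)
      have k1C: "\<bar>k1 x y\<bar> \<le> C" if "x \<in> space M" "y \<in> space M" for x y
      proof (rule psd_kernel_abs_le[OF k1 that])
        show "k1 x x \<le> C" "k1 y y \<le> C"
          using diag[OF that(1)] diag[OF that(2)] C by (auto simp: ennreal_le_iff)
      qed
      note bound = Schur_product_L2_bound[OF m1 k1C psd_kernel_sym[OF k1] psd m2 k2
          L2_opnorm_form_bound[OF lin2 eq_refl[OF \<kappa>(1)] \<kappa>(2)] \<kappa>(2) _ int2]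
      have "L2_integral_operator M ?k"
        by (rule L2_integral_operatorI[OF m]) (rule bound; assumption)+
      moreover have "L2_opnorm M (integral_op M ?k) \<le> ennreal (\<kappa> * C)"
        by (rule L2_opnorm_leI) (use bound \<kappa> C in auto)
      ultimately show ?thesis
        using \<kappa> C by (simp add: B_def ennreal_mult flip: S_def)
    qed
  qed
  then show "B < \<infinity> \<Longrightarrow> L2_integral_operator M ?k" and "L2_opnorm M (integral_op M ?k) \<le> B"
    by auto
qed

end

text \<open>As \<open>integral_op\<close> takes the value 0 where its integral diverges, the first
  conjunct certifies that, for a finite bound, the norm in the second one belongs to a genuine
  linear operator on \<open>L2\<close>.\<close>

theorem lemma12:
  fixes k1 k2 :: "real ^ 'n \<Rightarrow> real ^ 'n \<Rightarrow> real"
  assumes "psd_kernel (sphere 0 1) k1"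
    and "psd_kernel (sphere 0 1) k2"
    and "L2_integral_operator sphere_measure k1"
    and "L2_integral_operator sphere_measure k2"
    and "L2_psd_operator sphere_measure (integral_op sphere_measure k1)"
    and "L2_psd_operator sphere_measure (integral_op sphere_measure k2)"
  shows "(L2_opnorm sphere_measure (integral_op sphere_measure k2)
            * (SUP x\<in>sphere 0 1. ennreal \<bar>k1 x x\<bar>) < \<infinity> \<longrightarrow>
           L2_integral_operator sphere_measure (\<lambda>x y. k1 x y * k2 x y)) \<and>
         L2_opnorm sphere_measure (integral_op sphere_measure (\<lambda>x y. k1 x y * k2 x y))
           \<le> L2_opnorm sphere_measure (integral_op sphere_measure k2)
              * (SUP x\<in>sphere 0 1. ennreal \<bar>k1 x x\<bar>)"
proof -
  interpret prob_space "sphere_measure :: (real ^ 'n) measure"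
    by (rule prob_space_sphere_measure)
  have "0 \<le> L2_inner sphere_measure h (integral_op sphere_measure k1 h)"
    if "h \<in> L2 sphere_measure" for h
    using assms(5) that by (simp add: L2_psd_operator_def)
  from Schur_product_integral_operator[unfolded space_sphere_measure, OF assms(1-4) this]
  show ?thesis by blast
qed

end
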